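(* Let $k\in\mathbb C$ with $\Re(k)<0$ and let $\delta>0$. Let $f:\mathbb Q\to\mathbb C$ satisfy $f(x)=f(x+1)$ for all $x\in\mathbb Q\setminus[-1,0]$, and let $h:\mathbb R\setminus\{0\}\to\mathbb C$ be such that $h(x)=f(x)-|x|^{-k}f(-1/x)$ for all $x\in\mathbb Q\cap([-1,1]\setminus\{0\})$. Assume that $$\sup_{\substack{x,y\in\mathbb R\setminus\{0\}\\ |x-y|<e^{-\varepsilon^{\delta-1}},\ |x|>2\varepsilon}}|h(x)-h(y)|=o(1)\quad(\varepsilon\to0^+),\qquad h(x)=O\big(e^{|x|^{\delta-1}}\big)\ \text{ for all } x\in[-1,1]\setminus\{0\}.$$ Then there is a set $X\subset\mathbb R\setminus\mathbb Q$ of full Lebesgue measure such that for every $x\in X$ the limit $$f^\dagger(x):=\lim_{j\to\infty}f(x_j)$$ exists, where $x_j=[a_0(x);a_1(x),\dots,a_j(x)]$ are the convergents of the continued fraction expansion of $x$. If in addition $h$ is bounded, then for every $x\in X$ the limit $\lim_{\mathbb Q\ni y\to x}f(y)$ exists and equals $f^\dagger(x)$. In general, for any $\varepsilon>0$ there is a subset $X_\varepsilon\subset X$, invariant under $x\mapsto x+1$, with $\mathrm{meas}(X_\varepsilon\cap[0,1])\geq1-\varepsilon$, such that the restriction $f^\dagger|_{X_\varepsilon}$ is continuous on $X_\varepsilon$ equipped with the subspace topology. In particular $f^\dagger$ is Lebesgue-measurable.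
   Context: $\mathrm{meas}$ denotes Lebesgue measure. For $x\in\mathbb R$, $x=[a_0;a_1,a_2,\dots]$ is its regular continued fraction expansion ($a_0\in\mathbb Z$, $a_i\geq1$ for $i\ge1$). *)

theory Defs
  imports "HOL-Analysis.Analysis"
begin

fun cf_rem :: "real \<Rightarrow> nat \<Rightarrow> real" where
  "cf_rem x 0 = x"
| "cf_rem x (Suc n) = 1 / frac (cf_rem x n)"

definition cf_digit :: "real \<Rightarrow> nat \<Rightarrow> int" where
  "cf_digit x n = \<lfloor>cf_rem x n\<rfloor>"

text \<open>cf_eval a i n = [a_i; a_(i+1), ..., a_(i+n)] as a rational number.\<close>
fun cf_eval :: "(nat \<Rightarrow> int) \<Rightarrow> nat \<Rightarrow> nat \<Rightarrow> rat" where
  "cf_eval a i 0 = of_int (a i)"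
| "cf_eval a i (Suc n) = of_int (a i) + 1 / cf_eval a (Suc i) n"

definition cf_conv :: "real \<Rightarrow> nat \<Rightarrow> rat" where
  "cf_conv x j = cf_eval (cf_digit x) 0 j"

definition fdag :: "(rat \<Rightarrow> complex) \<Rightarrow> real \<Rightarrow> complex" where
  "fdag f x = lim (\<lambda>j. f (cf_conv x j))"

end

(* For y > 0 rational, f y is a function of t = frac y, and substituting the relation for h into
   itself gives f y = Sum_i (t * T t * ... * T^(i-1) t)^(-k) * h (+- T^i t), where T t = frac (1 / t)
   is the Gauss map and the sum ends when T^i t = 0, with f (+- 1) replacing h; similarly for y < 0. The products decay
   geometrically, so y may be moved to an irrational x inside the sum by dominated convergence,
   with h continuous off 0. If h is bounded the domination is immediate. Otherwise it is needed
   that T^i x is eventually at least i^(-p) for some p > 1 with p * (1 - delta) < 1, so that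
   h (T^i x) grows subexponentially. By invariance of the Gauss measure and Borel-Cantelli this
   holds for almost all x, and it passes to the convergents of x. Finally, f^dagger is a limit of
   Borel functions, and the sets X_epsilon come from Lusin's theorem applied on one period. *)

theory Submission
  imports Defs "HOL-Real_Asymp.Real_Asymp"
begin

section \<open>The Gauss map and its invariant measure\<close>

text \<open>Polymorphic, so that the same map acts on rationals and on reals. Since
  \<open>1 / 0 = 0\<close>, the point \<open>0\<close> is fixed and an orbit that reaches it stays
  there.\<close>

definition gauss_map :: "'a::floor_ceiling \<Rightarrow> 'a" where
  "gauss_map t = frac (1 / t)"

abbreviation gauss_orbit :: "'a::floor_ceiling \<Rightarrow> nat \<Rightarrow> 'a" where
  "gauss_orbit t i \<equiv> (gauss_map ^^ i) t"

lemma gauss_orbit_Suc: "gauss_orbit t (Suc i) = gauss_orbit (gauss_map t) i"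
  by (simp add: funpow_swap1)

lemma gauss_map_0 [simp]: "gauss_map 0 = 0"
  by (simp add: gauss_map_def)

lemma gauss_orbit_0 [simp]: "gauss_orbit 0 i = 0"
  by (induction i) auto

lemma gauss_map_bounds: "0 \<le> gauss_map t" "gauss_map t < 1"
  by (auto simp: gauss_map_def frac_lt_1)

lemma gauss_orbit_bounds:
  assumes "0 \<le> t" "t < 1"
  shows "0 \<le> gauss_orbit t i" "gauss_orbit t i < 1"
  using assms by (cases i; simp add: gauss_map_bounds)+

lemma measurable_gauss_map [measurable]: "(gauss_map :: real \<Rightarrow> real) \<in> borel_measurable borel"
  unfolding gauss_map_def frac_def by measurable

lemma measurable_gauss_orbit [measurable]: "(\<lambda>t::real. gauss_orbit t i) \<in> borel_measurable borel"
  by (induction i) auto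

text \<open>The classical Gauss measure without the normalising factor \<open>1 / ln 2\<close>,
  extended by zero outside \<open>(0, 1)\<close>.\<close>

definition gauss_measure :: "real measure" where
  "gauss_measure = density lborel (\<lambda>x. ennreal (1 / (1 + x) * indicator {0<..<1} x))"

lemma space_gauss_measure [simp]: "space gauss_measure = UNIV"
  and sets_gauss_measure [simp, measurable_cong]: "sets gauss_measure = sets borel"
  by (auto simp: gauss_measure_def)

lemma emeasure_gauss_measure_unit:
  assumes [measurable]: "A \<in> sets borel"
  shows "emeasure gauss_measure A = emeasure gauss_measure (A \<inter> {0<..<1})"
  by (auto simp: gauss_measure_def emeasure_density intro!: nn_integral_cong split: split_indicator)

lemma emeasure_gauss_measure_Ioo:
  assumes "0 \<le> a" "a \<le> b" "b \<le> 1"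
  shows "emeasure gauss_measure {a<..<b} = ennreal (ln (1 + b) - ln (1 + a))"
proof -
  have "emeasure gauss_measure {a<..<b}
      = (\<integral>\<^sup>+x. ennreal (1 / (1 + x) * indicator {0<..<1} x) * indicator {a<..<b} x \<partial>lborel)"
    by (simp add: gauss_measure_def emeasure_density)
  also have "\<dots> = (\<integral>\<^sup>+x. ennreal (1 / (1 + x)) * indicator {a..b} x \<partial>lborel)"
    using AE_lborel_singleton[of a] AE_lborel_singleton[of b] assms
    by (intro nn_integral_cong_AE) (auto split: split_indicator)
  also have "\<dots> = ennreal (ln (1 + b) - ln (1 + a))"
    using assms
    by (intro nn_integral_FTC_Icc) (auto intro!: derivative_eq_intros simp: field_simps)
  finally show ?thesis .
qed

text \<open>The interval with index \<open>n\<close> is cut out of the branch on which the floor of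
  \<open>1 / x\<close> equals \<open>n + 1\<close>. Its left endpoint is excluded because
  \<open>gauss_map\<close> vanishes there.\<close>

lemma gauss_map_vimage:
  assumes "0 \<le> a" "a < 1"
  shows "gauss_map -` {a<..} \<inter> {0<..<1}
    = (\<Union>n. {1 / (real n + 2)<..<1 / (real n + 1 + a)})"
proof (intro equalityI subsetI)
  fix x :: real assume "x \<in> gauss_map -` {a<..} \<inter> {0<..<1}"
  hence x: "0 < x" "x < 1" "a < frac (1 / x)" by (auto simp: gauss_map_def)
  define n where "n = nat \<lfloor>1 / x\<rfloor> - 1"
  have "1 < 1 / x" using x by (simp add: field_simps)
  hence "\<lfloor>1 / x\<rfloor> \<ge> 1" by linarith
  hence n: "real_of_int \<lfloor>1 / x\<rfloor> = real n + 1" unfolding n_def by linarith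
  hence "real n + 1 + a < 1 / x" "1 / x < real n + 2"
    using x(3) floor_less_iff[of "1/x"] unfolding frac_def by linarith+
  thus "x \<in> (\<Union>n. {1 / (real n + 2)<..<1 / (real n + 1 + a)})"
    using x assms by (intro UN_I[of n]) (auto simp: field_simps)
next
  fix x :: real assume "x \<in> (\<Union>n. {1 / (real n + 2)<..<1 / (real n + 1 + a)})"
  then obtain n where n: "1 / (real n + 2) < x" "x < 1 / (real n + 1 + a)" by auto
  have "0 < 1 / (real n + 2)" by simp
  with n have x0: "0 < x" by linarith
  have *: "real n + 1 + a < 1 / x" "1 / x < real n + 2"
    using n x0 assms by (auto simp: field_simps)
  hence "\<lfloor>1 / x\<rfloor> = int n + 1" using assms by (intro floor_unique) auto
  hence "a < frac (1 / x)" using * by (simp add: frac_def)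
  moreover have "x < 1"
  proof -
    have "1 < 1 / x" using * assms by linarith
    thus ?thesis using x0 by (simp add: field_simps)
  qed
  ultimately show "x \<in> gauss_map -` {a<..} \<inter> {0<..<1}" using x0 by (auto simp: gauss_map_def)
qed

text \<open>The density has antiderivative \<open>ln (1 + x)\<close>, so branch \<open>n\<close> has
  mass \<open>w (Suc n) - w n\<close> and the sum over branches telescopes. The result is the mass
  of \<open>(a, 1)\<close>.\<close>

lemma emeasure_gauss_map_vimage:
  assumes a: "0 \<le> a" "a < 1"
  shows "emeasure gauss_measure (gauss_map -` {a<..}) = ennreal (ln 2 - ln (1 + a))"
proof -
  define A where "A n = {1 / (real n + 2)<..<1 / (real n + 1 + a)}" for n
  define w where "w n = ln ((real n + 1 + a) / (real n + 2))" for n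
  have le: "1 / (real n + 2) \<le> 1 / (real n + 1 + a)" "1 / (real n + 1 + a) \<le> 1 / (real n + 1)" for n
    using a by (auto simp: field_simps)
  have A_borel: "A n \<in> sets borel" for n by (simp add: A_def)
  have "disjoint_family A"
  proof -
    have "A m \<inter> A n = {}" if "m < n" for m n
    proof -
      have "1 / (real n + 1) \<le> 1 / (real m + 2)" using that by (simp add: field_simps)
      with le(2)[of n] show ?thesis by (auto simp: A_def)
    qed
    thus ?thesis unfolding disjoint_family_on_def by (metis inf_commute linorder_neqE_nat)
  qed
  hence "emeasure gauss_measure (\<Union>n. A n) = (\<Sum>n. emeasure gauss_measure (A n))"
    using A_borel by (intro suminf_emeasure[symmetric]) auto
  also have "\<dots> = (\<Sum>n. ennreal (w (Suc n) - w n))"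
  proof (intro suminf_cong)
    fix n
    have "1 / (real n + 1 + a) \<le> 1" using a by simp
    hence "emeasure gauss_measure (A n)
        = ennreal (ln (1 + 1 / (real n + 1 + a)) - ln (1 + 1 / (real n + 2)))"
      unfolding A_def using le[of n] by (intro emeasure_gauss_measure_Ioo) auto
    also have "1 + 1 / (real n + 1 + a) = (real (Suc n) + 1 + a) / (real n + 1 + a)"
      using a by (simp add: field_simps)
    also have "1 + 1 / (real n + 2) = (real (Suc n) + 2) / (real n + 2)"
      by (simp add: field_simps)
    also have "ln ((real (Suc n) + 1 + a) / (real n + 1 + a)) - ln ((real (Suc n) + 2) / (real n + 2))
       = w (Suc n) - w n"
      unfolding w_def using a by (simp add: ln_div)
    finally show "emeasure gauss_measure (A n) = ennreal (w (Suc n) - w n)" .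
  qed
  also have "\<dots> = ennreal (0 - w 0)"
  proof (rule suminf_ennreal_eq)
    show "(\<lambda>n. w (Suc n) - w n) sums (0 - w 0)"
    proof (rule telescope_sums)
      show "w \<longlonglongrightarrow> 0" unfolding w_def by real_asymp
    qed
    show "0 \<le> w (Suc n) - w n" for n
    proof -
      have "(real n + 1 + a) / (real n + 2) \<le> (real (Suc n) + 1 + a) / (real (Suc n) + 2)"
        using a by (simp add: field_simps)
      thus ?thesis unfolding w_def using a by simp
    qed
  qed
  also have "0 - w 0 = ln 2 - ln (1 + a)" using a by (simp add: w_def ln_div)
  finally show ?thesis
    using a by (subst emeasure_gauss_measure_unit)
      (auto simp: gauss_map_vimage A_def intro: measurable_sets_borel[OF measurable_gauss_map])
qed

text \<open>A Borel measure that is finite on open upper half-lines is determined by them. For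
  \<open>x < 0\<close> both sides are the total mass, for \<open>x \<ge> 1\<close> both vanish, and
  in between the sum over branches applies.\<close>

lemma gauss_measure_invariant: "distr gauss_measure borel gauss_map = gauss_measure"
proof (rule measure_eqI_lessThan)
  have D: "emeasure (distr gauss_measure borel gauss_map) {x<..} = emeasure gauss_measure (gauss_map -` {x<..})" for x
    by (simp add: emeasure_distr)
  have fin: "emeasure gauss_measure A < \<infinity>" if "A \<in> sets borel" for A
  proof -
    have "emeasure gauss_measure A = emeasure gauss_measure (A \<inter> {0<..<1})"
      by (rule emeasure_gauss_measure_unit[OF that])
    also have "\<dots> \<le> emeasure gauss_measure {0<..<1}"
      by (rule emeasure_mono) auto
    also have "\<dots> < \<infinity>" by (simp add: emeasure_gauss_measure_Ioo)
    finally show ?thesis .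
  qed
  fix x :: real
  show "emeasure (distr gauss_measure borel gauss_map) {x<..} < \<infinity>"
    unfolding D by (intro fin measurable_sets_borel[OF measurable_gauss_map]) auto
  consider "x < 0" | "0 \<le> x" "x < 1" | "1 \<le> x" by linarith
  thus "emeasure (distr gauss_measure borel gauss_map) {x<..} = emeasure gauss_measure {x<..}"
  proof cases
    case 1
    have "y \<in> gauss_map -` {x<..}" for y using gauss_map_bounds(1)[of y] 1 by auto
    hence "gauss_map -` {x<..} = UNIV" by blast
    moreover have "UNIV \<inter> {0<..<1} = {x<..} \<inter> {0<..<1::real}" using 1 by auto
    ultimately show ?thesis unfolding D
      by (metis emeasure_gauss_measure_unit borel_open open_UNIV open_greaterThan)
  next
    case 2
    have "{x<..} \<inter> {0<..<1} = {x<..<1}" using 2 by auto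
    thus ?thesis unfolding D using 2
      by (simp add: emeasure_gauss_map_vimage emeasure_gauss_measure_unit[of "{x<..}"]
          emeasure_gauss_measure_Ioo)
  next
    case 3
    have "y \<notin> gauss_map -` {x<..}" for y using gauss_map_bounds(2)[of y] 3 by auto
    hence "gauss_map -` {x<..} = {}" by blast
    moreover have "{x<..} \<inter> {0<..<1} = ({}::real set)" using 3 by auto
    ultimately show ?thesis unfolding D
      by (simp add: emeasure_gauss_measure_unit[of "{x<..}"])
  qed
qed auto

section \<open>Lower bounds along almost every orbit\<close>

lemma gauss_measure_orbit_invariant:
  "distr gauss_measure borel (\<lambda>t. gauss_orbit t i) = gauss_measure"
proof (induction i)
  case (Suc i)
  have "distr gauss_measure borel (\<lambda>t. gauss_orbit t (Suc i))
      = distr (distr gauss_measure borel gauss_map) borel (\<lambda>t. gauss_orbit t i)"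
    by (subst distr_distr) (auto simp: comp_def funpow_swap1)
  with Suc show ?case by (simp add: gauss_measure_invariant)
qed (simp add: distr_id2)

text \<open>Invariance reduces the claim to \<open>i = 0\<close>, where it is the inequality
  \<open>ln (1 + d) \<le> d\<close>.\<close>

lemma emeasure_gauss_orbit_small:
  assumes "0 \<le> c"
  shows "emeasure gauss_measure {t. gauss_orbit t i < c} \<le> ennreal c"
proof -
  \<comment> \<open>The Gauss measure has no mass beyond \<open>1\<close>, and the formula for
    intervals needs an endpoint at most \<open>1\<close>.\<close>
  define d where "d = min c 1"
  have d: "0 \<le> d" "d \<le> 1" "d \<le> c" using assms by (auto simp: d_def)
  have "emeasure gauss_measure {t. gauss_orbit t i < c}
      = emeasure (distr gauss_measure borel (\<lambda>t. gauss_orbit t i)) {..<c}"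
    by (simp add: emeasure_distr vimage_def)
  also have "\<dots> = emeasure gauss_measure {..<c}"
    by (simp add: gauss_measure_orbit_invariant)
  also have "\<dots> = emeasure gauss_measure {0<..<d}"
    by (subst emeasure_gauss_measure_unit) (auto simp: d_def intro!: arg_cong[where f="emeasure gauss_measure"])
  also have "\<dots> = ennreal (ln (1 + d))"
    using d by (simp add: emeasure_gauss_measure_Ioo)
  also have "\<dots> \<le> ennreal c"
    using d ln_add_one_self_le_self[of d] by (intro ennreal_leI) linarith
  finally show ?thesis .
qed

text \<open>Borel-Cantelli for the Gauss measure. Its density is positive on \<open>(0, 1)\<close>,
  so the conclusion carries over to Lebesgue measure there.\<close>

lemma AE_gauss_orbit_ge:
  fixes c :: "nat \<Rightarrow> real"
  assumes "\<And>i. 0 \<le> c i" "summable c"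
  shows "AE t in lborel. 0 < t \<and> t < 1 \<longrightarrow> (\<forall>\<^sub>F i in sequentially. c i \<le> gauss_orbit t i)"
proof -
  have bd: "emeasure gauss_measure {t. gauss_orbit t i < c i} \<le> ennreal (c i)" for i
    using assms by (intro emeasure_gauss_orbit_small)
  have "AE t in gauss_measure. \<forall>\<^sub>F i in sequentially. t \<in> space gauss_measure - {t. gauss_orbit t i < c i}"
  proof (rule borel_cantelli_AE1)
    show "emeasure gauss_measure {t. gauss_orbit t n < c n} < \<infinity>" for n
      using bd[of n] by (auto intro: le_less_trans)
    show "summable (\<lambda>n. measure gauss_measure {t. gauss_orbit t n < c n})"
    proof (rule summable_comparison_test'[OF assms(2), of 0])
      fix n
      show "norm (measure gauss_measure {t. gauss_orbit t n < c n}) \<le> c n"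
        using enn2real_mono[OF bd[of n]] assms(1)[of n] by (simp add: measure_def)
    qed
  qed auto
  hence "AE t in lborel. 0 < t \<and> t < 1 \<longrightarrow> (\<forall>\<^sub>F i in sequentially. \<not> gauss_orbit t i < c i)"
    unfolding gauss_measure_def by (subst (asm) AE_density) (auto elim!: eventually_mono)
  thus ?thesis by (simp add: not_less)
qed

section \<open>Continued fractions along the Gauss map\<close>

lemma of_rat_frac: "(of_rat (frac r) :: real) = frac (of_rat r)"
  by (simp add: frac_def of_rat_diff)

lemma of_rat_gauss_map: "(of_rat (gauss_map r) :: real) = gauss_map (of_rat r)"
  by (simp add: gauss_map_def of_rat_frac of_rat_divide)

lemma frac_add_of_int: "frac (of_int n + x) = frac x"
  by (simp add: frac_def)

lemma frac_rational_iff: "frac (t::real) \<in> \<rat> \<longleftrightarrow> t \<in> \<rat>"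
proof
  assume "frac t \<in> \<rat>"
  hence "frac t + of_int \<lfloor>t\<rfloor> \<in> \<rat>" by (intro Rats_add) auto
  thus "t \<in> \<rat>" by (simp add: frac_def)
qed (auto simp: frac_def)

lemma irrational_not_int: "(t::real) \<notin> \<rat> \<Longrightarrow> t \<notin> \<int>"
  using Ints_subset_Rats by auto

lemma irrational_inverse: "(t::real) \<notin> \<rat> \<Longrightarrow> 1 / t \<notin> \<rat>"
  using Rats_divide[of 1 "1 / t"] by auto

lemma gauss_map_irrational: "(t::real) \<notin> \<rat> \<Longrightarrow> gauss_map t \<notin> \<rat>"
  by (simp add: gauss_map_def frac_rational_iff irrational_inverse)

lemma gauss_orbit_irrational: "(t::real) \<notin> \<rat> \<Longrightarrow> gauss_orbit t i \<notin> \<rat>"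
  by (induction i) (auto simp: gauss_map_irrational)

lemma gauss_orbit_irrational_pos:
  assumes "(t::real) \<notin> \<rat>" "0 \<le> t" "t < 1"
  shows "0 < gauss_orbit t i"
  using gauss_orbit_irrational[OF assms(1), of i] gauss_orbit_bounds(1)[OF assms(2,3), of i]
  by (cases "gauss_orbit t i = 0") auto

lemma isCont_frac: "(t::real) \<notin> \<rat> \<Longrightarrow> isCont frac t"
  by (intro continuous_frac irrational_not_int)

lemma isCont_gauss_map:
  assumes "(t::real) \<notin> \<rat>"
  shows "isCont gauss_map t"
proof -
  have "t \<noteq> 0" using assms by auto
  hence "isCont (\<lambda>t. 1 / t) t" by (intro continuous_intros) auto
  moreover have "isCont frac (1 / t)" by (intro isCont_frac irrational_inverse assms)
  ultimately have "isCont (\<lambda>t. frac (1 / t)) t" by (rule isCont_o2)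
  thus ?thesis by (simp add: gauss_map_def[abs_def])
qed

lemma isCont_gauss_orbit:
  assumes "(t::real) \<notin> \<rat>"
  shows "isCont (\<lambda>t. gauss_orbit t i) t"
proof (induction i)
  case (Suc i)
  have "isCont (\<lambda>t. gauss_map (gauss_orbit t i)) t"
    by (rule isCont_o2[OF Suc]) (intro isCont_gauss_map gauss_orbit_irrational assms)
  thus ?case by simp
qed auto

text \<open>Two consecutive orbit points cannot both be close to \<open>1\<close>; this is the
  source of the geometric decay.\<close>

lemma mult_gauss_map_le:
  fixes t :: real
  assumes "0 \<le> t" "t < 1"
  shows "t * gauss_map t \<le> 1 / 2"
proof (cases "t \<le> 1 / 2")
  case True
  have "t * gauss_map t \<le> t * 1"
    using assms gauss_map_bounds[of t] by (intro mult_left_mono) auto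
  with True show ?thesis by simp
next
  case False
  hence "\<lfloor>1 / t\<rfloor> = 1" using assms by (intro floor_unique) (auto simp: field_simps)
  hence "t * gauss_map t = 1 - t" using False by (simp add: gauss_map_def frac_def field_simps)
  with False show ?thesis by simp
qed

text \<open>Each pair of consecutive factors contributes at most \<open>1 / 2\<close>, that is
  \<open>sqrt (1 / 2)\<close> per factor. The constant \<open>2\<close> absorbs an unpaired
  factor.\<close>

lemma prod_gauss_orbit_le:
  fixes t :: real
  assumes t: "0 \<le> t" "t < 1"
  shows "(\<Prod>l<n. gauss_orbit t l) \<le> 2 * sqrt (1 / 2) ^ n"
proof (induction n rule: less_induct)
  case (less n)
  consider "n = 0" | "n = 1" | m where "n = Suc (Suc m)" by (metis One_nat_def not0_implies_Suc)
  thus ?case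
  proof cases
    case 2
    have "sqrt 2 \<le> sqrt 4" by (intro real_sqrt_le_mono) simp
    hence "(1::real) \<le> 2 * sqrt (1 / 2)" by (simp add: real_sqrt_divide)
    thus ?thesis using 2 t by simp
  next
    case (3 m)
    have o: "0 \<le> gauss_orbit t m" "gauss_orbit t m < 1" using gauss_orbit_bounds[OF t] by auto
    have "(\<Prod>l<n. gauss_orbit t l) = (\<Prod>l<m. gauss_orbit t l) * (gauss_orbit t m * gauss_map (gauss_orbit t m))"
      by (simp add: 3)
    also have "\<dots> \<le> (2 * sqrt (1 / 2) ^ m) * (1 / 2)"
      using less[of m] mult_gauss_map_le[OF o] o 3 gauss_map_bounds gauss_orbit_bounds[OF t]
      by (intro mult_mono mult_nonneg_nonneg prod_nonneg) auto
    also have "\<dots> = 2 * sqrt (1 / 2) ^ n" by (simp add: 3)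
    finally show ?thesis .
  qed auto
qed

lemma prod_gauss_orbit_nonneg:
  fixes t :: real
  assumes "0 \<le> t" "t < 1"
  shows "0 \<le> (\<Prod>l<n. gauss_orbit t l)"
  using gauss_orbit_bounds[OF assms] by (intro prod_nonneg) auto

section \<open>Remainders, digits and convergents in terms of orbits\<close>

lemma frac_cf_rem: "frac (cf_rem x i) = gauss_orbit (frac x) i"
  by (induction i) (auto simp: gauss_map_def)

lemma cf_rem_Suc_irrational:
  assumes "x \<notin> \<rat>"
  shows "cf_rem x (Suc i) > 1"
proof -
  have "0 < gauss_orbit (frac x) i" "gauss_orbit (frac x) i < 1"
    using assms gauss_orbit_irrational_pos[of "frac x"] gauss_orbit_bounds[of "frac x"]
    by (auto simp: frac_rational_iff frac_lt_1)
  thus ?thesis by (simp add: frac_cf_rem field_simps)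
qed

lemma cf_digit_pos: "x \<notin> \<rat> \<Longrightarrow> i > 0 \<Longrightarrow> cf_digit x i \<ge> 1"
  using cf_rem_Suc_irrational[of x "i - 1"] by (auto simp: cf_digit_def le_floor_iff)

lemma cf_eval_ge_1:
  assumes "\<And>i. i > 0 \<Longrightarrow> a i \<ge> 1" "i > 0"
  shows "cf_eval a i n \<ge> 1"
  using assms(2)
proof (induction n arbitrary: i)
  case (Suc n)
  have "0 \<le> 1 / cf_eval a (Suc i) n" using Suc.IH[of "Suc i"] by simp
  moreover have "(1::rat) \<le> of_int (a i)" using assms(1)[OF Suc.prems] by simp
  ultimately show ?case by (simp only: cf_eval.simps)
qed (use assms in simp)

lemma cf_eval_le:
  assumes "\<And>i. i > 0 \<Longrightarrow> a i \<ge> 1"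
  shows "cf_eval a i n \<le> of_int (a i) + 1"
  using cf_eval_ge_1[of a "Suc i" "n - 1"] assms by (cases n) auto

lemma frac_one_div:
  fixes c :: rat
  assumes "c \<ge> 1"
  shows "frac (1 / c) = (if c = 1 then 0 else 1 / c)"
  using assms by (auto simp: frac_eq)

text \<open>The Gauss map deletes the leading digit. If the remaining tail equals \<open>1\<close>,
  its reciprocal has fractional part \<open>0\<close>, and both sides are \<open>0\<close>.\<close>

lemma gauss_map_frac_cf_eval:
  assumes "\<And>i. i > 0 \<Longrightarrow> a i \<ge> 1"
  shows "gauss_map (frac (cf_eval a i (Suc n))) = frac (cf_eval a (Suc i) n)"
  using cf_eval_ge_1[of a "Suc i" n] assms
  by (simp add: frac_add_of_int frac_one_div) (simp add: gauss_map_def)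

lemma gauss_orbit_frac_cf_eval:
  assumes "\<And>i. i > 0 \<Longrightarrow> a i \<ge> 1"
  shows "gauss_orbit (frac (cf_eval a 0 (i + n))) i = frac (cf_eval a i n)"
proof (induction i arbitrary: n)
  case (Suc i)
  show ?case using Suc[of "Suc n"] gauss_map_frac_cf_eval[of a i n, OF assms] by simp
qed simp

text \<open>For \<open>n > 0\<close> the fractional part is the reciprocal of a tail between
  \<open>1\<close> and \<open>a (Suc i) + 1\<close>, except that a tail equal to \<open>1\<close>
  gives \<open>0\<close>.\<close>

lemma frac_cf_eval_dichotomy:
  assumes "\<And>i. i > 0 \<Longrightarrow> a i \<ge> 1"
  shows "frac (cf_eval a i n) = 0 \<or> frac (cf_eval a i n) \<ge> 1 / (of_int (a (Suc i)) + 1)"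
proof (cases n)
  case (Suc m)
  have "1 \<le> cf_eval a (Suc i) m" "cf_eval a (Suc i) m \<le> of_int (a (Suc i)) + 1"
    using cf_eval_ge_1[of a "Suc i" m] cf_eval_le[of a] assms by auto
  thus ?thesis
    by (simp add: Suc frac_add_of_int frac_one_div) (simp add: field_simps)
qed simp

lemma of_rat_gauss_orbit: "(of_rat (gauss_orbit r i) :: real) = gauss_orbit (of_rat r) i"
  by (induction i) (auto simp: of_rat_gauss_map)

text \<open>The alternative \<open>0\<close> occurs when the expansion of the convergent has terminated; this can
  happen one step early, since a final digit \<open>1\<close> is absorbed by its predecessor.\<close>

lemma gauss_orbit_convergent:
  assumes x: "x \<notin> \<rat>"
  shows "gauss_orbit (frac (real_of_rat (cf_conv x j))) i = 0
    \<or> gauss_orbit (frac x) i / 2 \<le> gauss_orbit (frac (real_of_rat (cf_conv x j))) i"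
proof -
  let ?a = "cf_digit x" and ?o = "gauss_orbit (frac x) i"
  have pos: "\<And>i. i > 0 \<Longrightarrow> ?a i \<ge> 1" using cf_digit_pos[OF x] .
  have orb: "gauss_orbit (frac (real_of_rat (cf_conv x j))) i
      = real_of_rat (gauss_orbit (frac (cf_conv x j)) i)"
    by (simp add: of_rat_gauss_orbit of_rat_frac)
  show ?thesis
  proof (cases "i \<le> j")
    case True
    then obtain n where j: "j = i + n" using le_Suc_ex by blast
    have eq: "gauss_orbit (frac (cf_conv x j)) i = frac (cf_eval ?a i n)"
      unfolding cf_conv_def j by (rule gauss_orbit_frac_cf_eval[OF pos])
    have o: "0 < ?o" "?o < 1"
      using x gauss_orbit_irrational_pos[of "frac x"] gauss_orbit_bounds[of "frac x"]
      by (auto simp: frac_rational_iff frac_lt_1)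
    \<comment> \<open>The next digit is the floor of \<open>1 / ?o\<close>. As
      \<open>?o < 1\<close>, adding \<open>1\<close> at most doubles \<open>1 / ?o\<close>, whence
      the factor \<open>1 / 2\<close> in the claim.\<close>
    have "of_int (?a (Suc i)) \<le> 1 / ?o"
      by (simp add: cf_digit_def frac_cf_rem)
    also have "1 / ?o + 1 \<le> 2 / ?o" using o by (simp add: field_simps)
    finally have "real_of_int (?a (Suc i)) + 1 \<le> 2 / ?o" by simp
    moreover have "real_of_int (?a (Suc i)) + 1 > 0" using pos[of "Suc i"] by simp
    ultimately have "1 / (2 / ?o) \<le> 1 / (real_of_int (?a (Suc i)) + 1)"
      by (intro divide_left_mono) (use o in auto)
    hence le: "?o / 2 \<le> 1 / (real_of_int (?a (Suc i)) + 1)" by simp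
    have "frac (cf_eval ?a i n) = 0 \<or> 1 / (of_int (?a (Suc i)) + 1) \<le> frac (cf_eval ?a i n)"
      by (rule frac_cf_eval_dichotomy[OF pos])
    moreover have "1 / (real_of_int (?a (Suc i)) + 1) = real_of_rat (1 / (of_int (?a (Suc i)) + 1))"
      by (simp add: of_rat_divide of_rat_add)
    ultimately show ?thesis unfolding orb eq using le
      by (metis of_rat_0 of_rat_less_eq order_trans)
  next
    case False
    then obtain d where i: "i = d + j" using le_Suc_ex by (metis add.commute nat_le_linear)
    \<comment> \<open>After \<open>j\<close> steps only the integer digit \<open>?a j\<close> is
      left.\<close>
    have "gauss_orbit (frac (cf_conv x j)) j = 0"
      using gauss_orbit_frac_cf_eval[of ?a j 0] pos by (simp add: cf_conv_def)
    hence "gauss_orbit (frac (cf_conv x j)) i = 0" by (simp add: i funpow_add)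
    thus ?thesis by (simp add: orb)
  qed
qed

text \<open>Taking reciprocals of \<open>r\<close> and \<open>c\<close> divides their distance by
  \<open>r * c\<close>. Here \<open>1 / r\<close> is an orbit point, and the factor
  \<open>1 / c\<close> is at most \<open>1\<close>, so every level contributes one orbit
  point.\<close>

lemma cf_rem_minus_cf_eval:
  assumes x: "x \<notin> \<rat>"
  shows "\<bar>cf_rem x i - real_of_rat (cf_eval (cf_digit x) i n)\<bar> \<le> (\<Prod>l<n. gauss_orbit (frac x) (i + l))"
proof (induction n arbitrary: i)
  case 0
  show ?case using frac_lt_1[of "cf_rem x i"] frac_ge_0[of "cf_rem x i"]
    by (simp add: cf_digit_def frac_def)
next
  case (Suc n)
  define c where "c = real_of_rat (cf_eval (cf_digit x) (Suc i) n)"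
  define r where "r = cf_rem x (Suc i)"
  have "cf_eval (cf_digit x) (Suc i) n \<ge> 1"
    by (intro cf_eval_ge_1 cf_digit_pos[OF x]) auto
  hence c: "c \<ge> 1" by (simp add: c_def)
  have r: "r > 1" unfolding r_def by (rule cf_rem_Suc_irrational[OF x])
  have or: "gauss_orbit (frac x) i = 1 / r" by (simp add: r_def frac_cf_rem)
  have "cf_rem x i = cf_digit x i + 1 / r" by (simp add: r_def cf_digit_def frac_def)
  moreover have "real_of_rat (cf_eval (cf_digit x) i (Suc n)) = cf_digit x i + 1 / c"
    by (simp add: c_def of_rat_add of_rat_divide)
  ultimately have "\<bar>cf_rem x i - real_of_rat (cf_eval (cf_digit x) i (Suc n))\<bar> = \<bar>1 / r - 1 / c\<bar>" by simp
  also have "\<dots> = 1 / r * (\<bar>r - c\<bar> / c)"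
    using r c by (simp add: field_simps abs_if)
  also have "\<dots> \<le> 1 / r * \<bar>r - c\<bar>"
    using r c by (intro mult_left_mono) (auto simp: divide_le_eq mult_le_cancel_left1)
  also have "\<dots> \<le> 1 / r * (\<Prod>l<n. gauss_orbit (frac x) (Suc i + l))"
    using Suc[of "Suc i"] r unfolding r_def c_def by (intro mult_left_mono) auto
  also have "\<dots> = (\<Prod>l<Suc n. gauss_orbit (frac x) (i + l))"
    by (subst prod.lessThan_Suc_shift) (simp add: or)
  finally show ?case .
qed

lemma cf_conv_tendsto:
  assumes x: "x \<notin> \<rat>"
  shows "(\<lambda>j. real_of_rat (cf_conv x j)) \<longlonglongrightarrow> x"
proof -
  have "(\<lambda>j. 2 * sqrt (1 / 2) ^ j) \<longlonglongrightarrow> 2 * 0"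
    by (intro tendsto_intros LIMSEQ_power_zero) (auto simp: real_sqrt_divide)
  hence lim: "(\<lambda>j. 2 * sqrt (1 / 2) ^ j) \<longlonglongrightarrow> 0" by simp
  have "norm (real_of_rat (cf_conv x j) - x) \<le> 2 * sqrt (1 / 2) ^ j" for j
    using cf_rem_minus_cf_eval[OF x, of 0 j] prod_gauss_orbit_le[of "frac x" j] frac_lt_1[of x]
    by (simp add: cf_conv_def abs_minus_commute)
  hence "(\<lambda>j. real_of_rat (cf_conv x j) - x) \<longlonglongrightarrow> 0"
    by (intro Lim_null_comparison[OF _ lim]) auto
  thus ?thesis by (simp add: LIM_zero_iff)
qed

text \<open>For \<open>u < 1 / 2\<close> one step takes \<open>1 - u\<close> to
  \<open>u / (1 - u)\<close>, whose reciprocal \<open>1 / u - 1\<close> differs from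
  \<open>1 / u\<close> by an integer. At \<open>u = 1 / 2\<close> the floor jumps, and both sides
  are \<open>0\<close>.\<close>

lemma gauss_map_reflect:
  fixes u :: real
  assumes "0 < u" "u \<le> 1 / 2"
  shows "gauss_map (gauss_map (1 - u)) = gauss_map u"
proof (cases "u = 1 / 2")
  case True
  show ?thesis unfolding True by (simp add: gauss_map_def frac_def)
next
  case False
  with assms have u: "0 < u" "u < 1 / 2" by auto
  have "\<lfloor>1 / (1 - u)\<rfloor> = 1" using u by (intro floor_unique) (auto simp: field_simps)
  hence g: "gauss_map (1 - u) = u / (1 - u)" using u by (simp add: gauss_map_def frac_def field_simps)
  have "1 / (u / (1 - u)) = of_int (-1) + 1 / u" using u by (simp add: field_simps)
  thus ?thesis unfolding g gauss_map_def[of "u / (1 - u)"] by (simp only: frac_add_of_int gauss_map_def)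
qed

text \<open>If \<open>u = [0; a\<^sub>1, a\<^sub>2, \<dots>]\<close> then \<open>1 - u\<close> is \<open>[0; 1, a\<^sub>1 - 1, a\<^sub>2, \<dots>]\<close> or \<open>[0; a\<^sub>2 + 1, a\<^sub>3, \<dots>]\<close>.\<close>

lemma gauss_orbit_frac_minus:
  fixes y :: real
  shows "(\<forall>i. gauss_orbit (frac (- y)) (Suc (Suc i)) = gauss_orbit (frac y) (Suc i)) \<or>
         (\<forall>i. gauss_orbit (frac (- y)) (Suc i) = gauss_orbit (frac y) (Suc (Suc i)))"
proof (cases "y \<in> \<int>")
  case True
  hence "frac y = 0" "frac (- y) = 0" by (simp_all add: frac_neg)
  thus ?thesis unfolding \<open>frac y = 0\<close> \<open>frac (- y) = 0\<close> gauss_orbit_0 by simp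
next
  case False
  define u where "u = frac y"
  have u: "0 < u" "u < 1" using False by (auto simp: u_def frac_lt_1 frac_gt_0_iff)
  have m: "frac (- y) = 1 - u" using False by (simp add: frac_neg u_def)
  show ?thesis
  proof (cases "u \<le> 1 / 2")
    case True
    thus ?thesis unfolding m u_def[symmetric]
      using gauss_map_reflect[of u] u by (simp add: gauss_orbit_Suc del: funpow.simps)
  next
    case False
    thus ?thesis unfolding m u_def[symmetric]
      using gauss_map_reflect[of "1 - u"] u by (simp add: gauss_orbit_Suc del: funpow.simps)
  qed
qed

section \<open>Expansion of a period function along the Gauss map\<close>

text \<open>The value \<open>t = 0\<close> encodes a terminated orbit; there \<open>f\<close> is evaluated at an integer of sign \<open>s\<close>,
  hence equals \<open>f s\<close> by periodicity. All later orbit terms vanish, as \<open>0 powr z = 0\<close>.\<close>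

definition base_value :: "(rat \<Rightarrow> complex) \<Rightarrow> (real \<Rightarrow> complex) \<Rightarrow> rat \<Rightarrow> real \<Rightarrow> complex" where
  "base_value f h s t = (if t = 0 then f s else h (real_of_rat s * t))"

text \<open>The sign alternates because \<open>x \<mapsto> - 1 / x\<close> exchanges the two
  half-lines.\<close>

definition orbit_term ::
    "complex \<Rightarrow> (rat \<Rightarrow> complex) \<Rightarrow> (real \<Rightarrow> complex) \<Rightarrow> rat \<Rightarrow> real \<Rightarrow> nat \<Rightarrow> complex" where
  "orbit_term k f h s t i =
     complex_of_real (\<Prod>l<i. gauss_orbit t l) powr (- k) * base_value f h (s * (- 1) ^ i) (gauss_orbit t i)"

text \<open>Periodicity of \<open>f\<close> does not connect negative with positive arguments, so
  the sign of \<open>x\<close> is kept separately from the fractional part of its modulus.\<close>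

definition orbit_series ::
    "complex \<Rightarrow> (rat \<Rightarrow> complex) \<Rightarrow> (real \<Rightarrow> complex) \<Rightarrow> real \<Rightarrow> complex" where
  "orbit_series k f h x = (\<Sum>i. orbit_term k f h (if x > 0 then 1 else - 1) (frac \<bar>x\<bar>) i)"

lemma orbit_term_0: "orbit_term k f h s t 0 = base_value f h s t"
  by (simp add: orbit_term_def)

text \<open>The complex power is multiplicative here since both bases are nonnegative reals.\<close>

lemma orbit_term_Suc:
  assumes "0 \<le> t" "t < 1"
  shows "orbit_term k f h s t (Suc i)
    = complex_of_real t powr (- k) * orbit_term k f h (- s) (gauss_map t) i"
proof -
  have "(\<Prod>l<Suc i. gauss_orbit t l) = t * (\<Prod>l<i. gauss_orbit (gauss_map t) l)"
    unfolding prod.lessThan_Suc_shift gauss_orbit_Suc by simp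
  moreover have "0 \<le> (\<Prod>l<i. gauss_orbit (gauss_map t) l)"
    by (intro prod_gauss_orbit_nonneg gauss_map_bounds)
  ultimately have "complex_of_real (\<Prod>l<Suc i. gauss_orbit t l) powr (- k)
      = complex_of_real t powr (- k) * complex_of_real (\<Prod>l<i. gauss_orbit (gauss_map t) l) powr (- k)"
    using assms by (simp only: of_real_mult) (intro powr_times_real, auto simp del: of_real_prod)
  thus ?thesis
    unfolding orbit_term_def gauss_orbit_Suc by simp
qed

text \<open>The oscillation condition enters as continuity off \<open>0\<close>. Bounds on
  \<open>h\<close> are left to the individual lemmas, since the two limit statements rely on
  different ones.\<close>

locale period_function =
  fixes k :: complex and f :: "rat \<Rightarrow> complex" and h :: "real \<Rightarrow> complex"
  assumes k_neg: "Re k < 0"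
    and f_per: "\<And>x::rat. \<not> (-1 \<le> x \<and> x \<le> 0) \<Longrightarrow> f x = f (x + 1)"
    and h_eq: "\<And>x::rat. x \<noteq> 0 \<Longrightarrow> -1 \<le> x \<Longrightarrow> x \<le> 1 \<Longrightarrow>
        h (real_of_rat x) = f x - (complex_of_real \<bar>real_of_rat x\<bar>) powr (-k) * f (- 1 / x)"
    and h_cont: "\<And>x. x \<noteq> 0 \<Longrightarrow> isCont h x"
begin

lemma f_shift:
  assumes "s \<in> {1, - 1}" "0 < x"
  shows "f (s * (x + of_nat n)) = f (s * x)"
proof (induction n)
  case (Suc n)
  have "f (s * (x + of_nat (Suc n))) = f (s * (x + of_nat n))"
  proof (cases "s = 1")
    case True
    have "\<not> x + of_nat n \<le> 0" using assms by (simp add: add_pos_nonneg not_le)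
    thus ?thesis using f_per[of "x + of_nat n"] True by (simp add: algebra_simps)
  next
    case False
    hence s: "s = - 1" using assms by simp
    \<comment> \<open>On the negative side the period relation is applied at the left one of the two
      points, which lies below \<open>- 1\<close>.\<close>
    have "\<not> - 1 \<le> - (x + of_nat n + 1)" using assms by (simp add: add_pos_nonneg not_le)
    thus ?thesis using f_per[of "- (x + of_nat n + 1)"] s by (simp add: algebra_simps)
  qed
  with Suc show ?case by simp
qed simp

lemma f_frac:
  assumes s: "s \<in> {1, - 1}" and x: "0 < x"
  shows "f (s * x) = (if frac x = 0 then f s else f (s * frac x))"
proof -
  define n where "n = nat \<lfloor>x\<rfloor>"
  have xn: "x = frac x + of_nat n" using x by (simp add: n_def frac_def)
  show ?thesis
  proof (cases "frac x = 0")
    case True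
    with xn x have "n \<ge> 1" by (cases n) auto
    hence "x = 1 + of_nat (n - 1)" using xn True by (simp add: of_nat_diff)
    thus ?thesis using f_shift[OF s, of 1 "n - 1"] True by (simp del: of_nat_diff)
  next
    case False
    hence "0 < frac x" using frac_ge_0[of x] by linarith
    from f_shift[OF s this, of n] xn False show ?thesis by simp
  qed
qed

text \<open>This is the Euclidean algorithm: the Gauss map sends \<open>p / q\<close> to
  \<open>(q mod p) / p\<close>, whose denominator is smaller. The relation for \<open>h\<close> at
  \<open>s * t\<close> adds the term of index \<open>0\<close>, and \<open>f_frac\<close> reduces
  \<open>- s / t\<close> to the next orbit point.\<close>

lemma orbit_term_sums_aux:
  assumes "s \<in> {1, - 1}" "p < q"
  shows "orbit_term k f h s (real p / real q) sums
     (if p = 0 then f s else f (s * (of_nat p / of_nat q)))"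
  using assms
proof (induction q arbitrary: p s rule: less_induct)
  case (less q)
  define t where "t = (of_nat p / of_nat q :: rat)"
  have t: "real p / real q = real_of_rat t" by (simp add: t_def of_rat_divide)
  have t01: "0 \<le> t" "t < 1" using less.prems by (auto simp: t_def divide_less_eq)
  have t01': "0 \<le> real_of_rat t" "real_of_rat t < 1" using t01 by auto
  show ?case
  proof (cases "p = 0")
    case True
    have "orbit_term k f h s 0 (Suc i) = 0" for i
      by (subst orbit_term_Suc) auto
    hence "orbit_term k f h s 0 sums (0 + orbit_term k f h s 0 0)"
      by (subst sums_Suc_iff[symmetric]) (simp add: sums_0)
    thus ?thesis using True by (simp add: orbit_term_0 base_value_def)
  next
    case False
    hence tpos: "0 < t" using less.prems by (simp add: t_def)
    have gm: "gauss_map t = of_nat (q mod p) / of_nat p"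
    proof -
      have "1 / t = of_nat (q div p) + of_nat (q mod p) / of_nat p"
        using False by (simp add: t_def field_simps flip: of_nat_mult of_nat_add)
      hence "gauss_map t = frac (of_nat (q mod p) / of_nat p)"
        using frac_add_of_int[of "int (q div p)"] by (simp add: gauss_map_def)
      also have "\<dots> = of_nat (q mod p) / of_nat p"
        using False by (subst frac_eq) (auto simp: divide_less_eq)
      finally show ?thesis .
    qed
    have "orbit_term k f h (- s) (real (q mod p) / real p) sums
      (if q mod p = 0 then f (- s) else f (- s * (of_nat (q mod p) / of_nat p)))"
      using less.prems False by (intro less.IH) auto
    also have "real (q mod p) / real p = gauss_map (real_of_rat t)"
      unfolding of_rat_gauss_map[symmetric] gm by (simp add: of_rat_divide)
    also have "(if q mod p = 0 then f (- s) else f (- s * (of_nat (q mod p) / of_nat p)))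
       = (if gauss_map t = 0 then f (- s) else f (- s * gauss_map t))"
      using False by (auto simp: gm)
    also have "\<dots> = f (- s * (1 / t))"
      using less.prems tpos by (subst f_frac[of "- s" "1 / t"]) (auto simp: gauss_map_def)
    finally have "(\<lambda>i. complex_of_real (real_of_rat t) powr (- k) *
          orbit_term k f h (- s) (gauss_map (real_of_rat t)) i) sums
       (complex_of_real (real_of_rat t) powr (- k) * f (- s * (1 / t)))"
      by (rule sums_mult)
    hence "(\<lambda>i. orbit_term k f h s (real_of_rat t) (Suc i)) sums
       (complex_of_real (real_of_rat t) powr (- k) * f (- s * (1 / t)))"
      by (simp add: orbit_term_Suc[OF t01'])
    hence "orbit_term k f h s (real_of_rat t) sums
       (complex_of_real (real_of_rat t) powr (- k) * f (- s * (1 / t)) + orbit_term k f h s (real_of_rat t) 0)"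
      by (subst sums_Suc_iff[symmetric])
    also have "orbit_term k f h s (real_of_rat t) 0 = h (real_of_rat (s * t))"
      using tpos by (simp add: orbit_term_0 base_value_def of_rat_mult)
    also have "h (real_of_rat (s * t))
        = f (s * t) - complex_of_real (real_of_rat t) powr (- k) * f (- s * (1 / t))"
      using less.prems tpos t01 by (subst h_eq) (auto simp: of_rat_minus)
    finally show ?thesis using False by (simp add: t) (simp add: t_def)
  qed
qed

text \<open>Limits of \<open>f\<close> along rationals thereby become limits of the series.\<close>

lemma orbit_series_rat:
  assumes "y \<noteq> 0"
  shows "orbit_series k f h (real_of_rat y) = f y"
proof -
  define s :: rat where "s = (if y > 0 then 1 else - 1)"
  define t where "t = frac \<bar>y\<bar>"
  obtain a b where ab: "quotient_of t = (a, b)" by fastforce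
  have b: "b > 0" using quotient_of_denom_pos[OF ab] .
  have tab: "t = of_int a / of_int b" using quotient_of_div[OF ab] .
  have t: "0 \<le> t" "t < 1" by (auto simp: t_def frac_lt_1)
  have a: "0 \<le> a" "a < b" using t b by (auto simp: tab zero_le_divide_iff divide_less_eq)
  have tn: "t = of_nat (nat a) / of_nat (nat b)" using a b by (simp add: tab)
  have tr: "real (nat a) / real (nat b) = frac \<bar>real_of_rat y\<bar>"
    using arg_cong[OF tn, of real_of_rat]
    by (simp add: t_def of_rat_frac of_rat_divide abs_if of_rat_minus split: if_splits)
  have s: "s \<in> {1, - 1}" by (simp add: s_def)
  have "orbit_term k f h s (real (nat a) / real (nat b)) sums
     (if nat a = 0 then f s else f (s * (of_nat (nat a) / of_nat (nat b))))"
    using a by (intro orbit_term_sums_aux s) auto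
  also have "(if nat a = 0 then f s else f (s * (of_nat (nat a) / of_nat (nat b))))
      = (if t = 0 then f s else f (s * t))"
    unfolding tn[symmetric] using a b by (auto simp: tab)
  also have "\<dots> = f (s * \<bar>y\<bar>)"
    using f_frac[OF s, of "\<bar>y\<bar>"] assms by (simp add: t_def)
  also have "s * \<bar>y\<bar> = y" by (simp add: s_def)
  finally have "orbit_term k f h s (frac \<bar>real_of_rat y\<bar>) sums f y" unfolding tr .
  thus ?thesis unfolding orbit_series_def by (simp add: s_def sums_iff)
qed

text \<open>At an irrational point all orbit points are positive. Hence \<open>base_value\<close> is
  given by \<open>h\<close> nearby, and the product avoids the branch cut of the power.\<close>

lemma isCont_orbit_term:
  assumes t: "t \<notin> \<rat>" "0 \<le> t" "t < 1" and s: "s \<in> {1, - 1}"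
  shows "isCont (\<lambda>t. orbit_term k f h s t i) t"
proof -
  have pos: "0 < gauss_orbit t l" for l using gauss_orbit_irrational_pos[OF t] .
  define r where "r = real_of_rat (s * (- 1) ^ i)"
  have r: "r \<noteq> 0" using s by (auto simp: r_def)
  have o: "((\<lambda>t. gauss_orbit t l) \<longlongrightarrow> gauss_orbit t l) (at t)" for l
    using isCont_gauss_orbit[OF t(1)] by (simp add: isCont_def)
  have "((\<lambda>t. h (r * gauss_orbit t i)) \<longlongrightarrow> h (r * gauss_orbit t i)) (at t)"
    by (rule isCont_tendsto_compose[OF h_cont]) (use r pos[of i] in \<open>auto intro!: tendsto_intros o\<close>)
  moreover have "\<forall>\<^sub>F t in at t. h (r * gauss_orbit t i) = base_value f h (s * (- 1) ^ i) (gauss_orbit t i)"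
    using order_tendstoD(1)[OF o[of i] pos[of i]]
    by eventually_elim (auto simp: base_value_def r_def)
  ultimately have "((\<lambda>t. base_value f h (s * (- 1) ^ i) (gauss_orbit t i)) \<longlongrightarrow> h (r * gauss_orbit t i)) (at t)"
    by (rule Lim_transform_eventually)
  also have "h (r * gauss_orbit t i) = base_value f h (s * (- 1) ^ i) (gauss_orbit t i)"
    using pos[of i] by (auto simp: base_value_def r_def)
  finally have b: "((\<lambda>t. base_value f h (s * (- 1) ^ i) (gauss_orbit t i)) \<longlongrightarrow>
    base_value f h (s * (- 1) ^ i) (gauss_orbit t i)) (at t)" .
  have "(\<Prod>l<i. gauss_orbit t l) > 0" by (intro prod_pos) (simp add: pos)
  thus ?thesis unfolding isCont_def orbit_term_def
    by (intro tendsto_mult[OF _ b] tendsto_powr_complex tendsto_of_real tendsto_prod o tendsto_const)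
      (auto simp: complex_nonpos_Reals_iff simp del: of_real_prod)
qed

text \<open>The power has modulus \<open>?P powr (- Re k)\<close>, which increases with
  \<open>?P\<close> because \<open>Re k < 0\<close>.\<close>

lemma norm_orbit_term_le:
  assumes "0 \<le> t" "t < 1" "norm (base_value f h (s * (- 1) ^ i) (gauss_orbit t i)) \<le> B"
  shows "norm (orbit_term k f h s t i) \<le> (2 * sqrt (1 / 2) ^ i) powr (- Re k) * B"
proof -
  let ?P = "\<Prod>l<i. gauss_orbit t l"
  have P: "0 \<le> ?P" "?P \<le> 2 * sqrt (1 / 2) ^ i"
    using prod_gauss_orbit_nonneg prod_gauss_orbit_le assms by auto
  have "norm (complex_of_real ?P powr (- k)) = ?P powr (- Re k)"
    using P by (subst norm_powr_real_powr) (auto simp del: of_real_prod)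
  also have "\<dots> \<le> (2 * sqrt (1 / 2) ^ i) powr (- Re k)"
    using P k_neg by (intro powr_mono2) auto
  finally show ?thesis unfolding orbit_term_def norm_mult
    by (intro mult_mono assms) auto
qed

text \<open>Tannery's theorem, the dominated convergence theorem for series. The filter is arbitrary
  so as to cover both sequences of convergents and all rationals approaching
  \<open>x\<close>.\<close>

lemma f_tendsto_orbit_series:
  fixes y :: "'b \<Rightarrow> rat" and B :: "nat \<Rightarrow> real"
  assumes x: "x \<notin> \<rat>" and F: "F \<noteq> bot" and y: "((\<lambda>n. real_of_rat (y n)) \<longlongrightarrow> x) F"
    and bound: "\<forall>\<^sub>F n in F. \<forall>i\<ge>N. \<forall>s\<in>{1, -1}.
       norm (base_value f h s (gauss_orbit (frac \<bar>real_of_rat (y n)\<bar>) i)) \<le> B i"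
    and summable: "summable (\<lambda>i. (2 * sqrt (1 / 2) ^ i) powr (- Re k) * B i)"
  shows "((\<lambda>n. f (y n)) \<longlongrightarrow> orbit_series k f h x) F"
proof -
  define s :: rat where "s = (if x > 0 then 1 else - 1)"
  have s: "s \<in> {1, - 1}" by (simp add: s_def)
  have x0: "x \<noteq> 0" using x by auto
  have ax: "\<bar>x\<bar> \<notin> \<rat>" using x Rats_minus_iff by (auto simp: abs_if)
  have fx: "((\<lambda>n. frac \<bar>real_of_rat (y n)\<bar>) \<longlongrightarrow> frac \<bar>x\<bar>) F"
    by (intro isCont_tendsto_compose[OF isCont_frac] tendsto_rabs y ax)
  have "((\<lambda>n. \<Sum>i. orbit_term k f h s (frac \<bar>real_of_rat (y n)\<bar>) i) \<longlongrightarrow>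
     (\<Sum>i. orbit_term k f h s (frac \<bar>x\<bar>) i)) F"
  proof (intro conjunct2[OF conjunct2[OF tannerys_theorem]])
    show "((\<lambda>n. orbit_term k f h s (frac \<bar>real_of_rat (y n)\<bar>) i) \<longlongrightarrow> orbit_term k f h s (frac \<bar>x\<bar>) i) F" for i
      using ax s by (intro isCont_tendsto_compose[OF isCont_orbit_term fx]) (auto simp: frac_rational_iff frac_lt_1)
    show "\<forall>\<^sub>F (i, n) in sequentially \<times>\<^sub>F F. norm (orbit_term k f h s (frac \<bar>real_of_rat (y n)\<bar>) i)
        \<le> (2 * sqrt (1 / 2) ^ i) powr (- Re k) * B i"
      unfolding eventually_prod_filter
    proof (intro exI conjI allI impI)
      show "\<forall>\<^sub>F i in sequentially. N \<le> i" by (rule eventually_ge_at_top)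
      fix i n
      assume i: "N \<le> i"
      assume "\<forall>i\<ge>N. \<forall>s\<in>{1, -1}. norm (base_value f h s (gauss_orbit (frac \<bar>real_of_rat (y n)\<bar>) i)) \<le> B i"
      moreover have "s * (- 1) ^ i \<in> {1, - 1}" using s by (cases "even i") auto
      ultimately have "norm (base_value f h (s * (- 1) ^ i) (gauss_orbit (frac \<bar>real_of_rat (y n)\<bar>) i)) \<le> B i"
        using i by blast
      hence "norm (orbit_term k f h s (frac \<bar>real_of_rat (y n)\<bar>) i) \<le> (2 * sqrt (1 / 2) ^ i) powr (- Re k) * B i"
        by (intro norm_orbit_term_le) (auto simp: frac_lt_1)
      thus "case (i, n) of (i, n) \<Rightarrow> norm (orbit_term k f h s (frac \<bar>real_of_rat (y n)\<bar>) i)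
         \<le> (2 * sqrt (1 / 2) ^ i) powr (- Re k) * B i" by simp
    qed (rule bound)
  qed (use summable F in auto)
  \<comment> \<open>Eventually \<open>y n\<close> has the sign of \<open>x\<close>, so the fixed
    \<open>s\<close> is the sign that \<open>orbit_series\<close> uses at
    \<open>y n\<close>.\<close>
  moreover have "\<forall>\<^sub>F n in F. (\<Sum>i. orbit_term k f h s (frac \<bar>real_of_rat (y n)\<bar>) i) = f (y n)"
  proof (cases "x > 0")
    case True
    from order_tendstoD(1)[OF y True] show ?thesis
    proof eventually_elim
      case (elim n)
      thus ?case using True orbit_series_rat[of "y n"] by (simp add: orbit_series_def s_def)
    qed
  next
    case False
    hence "x < 0" using x0 by simp
    from order_tendstoD(2)[OF y this] show ?thesis
    proof eventually_elim
      case (elim n)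
      thus ?case using False orbit_series_rat[of "y n"] by (simp add: orbit_series_def s_def)
    qed
  qed
  ultimately show ?thesis unfolding orbit_series_def s_def by (rule Lim_transform_eventually)
qed

end

section \<open>Orbits approaching zero slowly\<close>

text \<open>For such \<open>x\<close> the partial quotients satisfy
  \<open>cf_digit x (Suc i) \<le> (i + 1) powr p\<close> for all large \<open>i\<close>.\<close>

definition slow_orbits :: "real \<Rightarrow> real set" where
  "slow_orbits p = {x. x \<notin> \<rat> \<and>
     (\<forall>\<^sub>F i in sequentially. (real i + 1) powr (- p) \<le> gauss_orbit (frac x) i)}"

lemma slow_orbits_add_1: "x + 1 \<in> slow_orbits p \<longleftrightarrow> x \<in> slow_orbits p"
proof -
  have "frac (x + 1) = frac x" using frac_add_of_int[of 1 x] by (simp add: add.commute)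
  moreover have "x + 1 \<in> \<rat> \<longleftrightarrow> x \<in> \<rat>" by (metis calculation frac_rational_iff)
  ultimately show ?thesis by (simp add: slow_orbits_def)
qed

text \<open>The bounds are summable for \<open>p > 1\<close>, so Borel-Cantelli gives a null set in
  the unit interval. Its integer translates and the rationals cover the complement.\<close>

lemma null_sets_slow_orbits_compl:
  assumes "p > 1"
  shows "- slow_orbits p \<in> null_sets lebesgue"
proof -
  let ?P = "\<lambda>t. \<forall>\<^sub>F i in sequentially. (real i + 1) powr (- p) \<le> gauss_orbit t i"
  have "summable (\<lambda>i. real (Suc i) powr (- p))"
    using assms by (subst summable_Suc_iff) (simp add: summable_real_powr_iff)
  hence "summable (\<lambda>i. (real i + 1) powr (- p))" by (simp add: add.commute)
  hence "AE t in lborel. 0 < t \<and> t < 1 \<longrightarrow> ?P t" by (intro AE_gauss_orbit_ge) auto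
  then obtain N where N: "N \<in> null_sets lborel" "{t. \<not> (0 < t \<and> t < 1 \<longrightarrow> ?P t)} \<subseteq> N"
    by (auto elim!: AE_E simp: null_sets_def)
  have "(\<Union>n::int. {x. x - of_int n \<in> N}) \<in> null_sets lborel"
    by (intro null_sets_UN null_sets_translation N)
  moreover have "\<rat> \<in> null_sets lborel"
    by (intro countable_imp_null_set_lborel countable_rat)
  ultimately have "\<rat> \<union> (\<Union>n::int. {x. x - of_int n \<in> N}) \<in> null_sets lborel" by (rule null_sets.Un[rotated])
  moreover have "- slow_orbits p \<subseteq> \<rat> \<union> (\<Union>n::int. {x. x - of_int n \<in> N})"
  proof
    fix x assume x: "x \<in> - slow_orbits p"
    show "x \<in> \<rat> \<union> (\<Union>n::int. {x. x - of_int n \<in> N})"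
    proof (cases "x \<in> \<rat>")
      case False
      hence "0 < frac x" "frac x < 1" by (auto simp: frac_gt_0_iff irrational_not_int frac_lt_1)
      moreover have "\<not> ?P (frac x)" using x False by (simp add: slow_orbits_def)
      ultimately have "frac x \<in> N" using N(2) by blast
      thus ?thesis by (auto simp: frac_def)
    qed simp
  qed
  ultimately show ?thesis
    using null_sets_completion_subset null_sets_completionI by blast
qed

text \<open>As \<open>\<theta> < 1\<close>, the exponent \<open>2 * (i + 2) powr \<theta>\<close> is
  \<open>o(i)\<close> and eventually uses up at most half of the exponential decay rate
  \<open>c\<close> of the first factor.\<close>

lemma summable_geometric_subexp:
  fixes \<kappa> \<theta> M C :: real
  assumes "0 < \<kappa>" "\<theta> < 1"
  shows "summable (\<lambda>i. (2 * sqrt (1 / 2) ^ i) powr \<kappa> * (M + C * exp (2 * (real i + 2) powr \<theta>)))"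
proof -
  define c where "c = \<kappa> * ln 2 / 2"
  have c: "c > 0" using assms by (simp add: c_def)
  have eq: "(2 * sqrt (1 / 2) ^ i) powr \<kappa> = 2 powr \<kappa> * exp (- c * i)" for i :: nat
  proof -
    have "(2 * sqrt (1 / 2) ^ i) powr \<kappa> = 2 powr \<kappa> * (sqrt (1 / 2) ^ i) powr \<kappa>"
      by (simp add: powr_mult)
    also have "(sqrt (1 / 2) ^ i) powr \<kappa> = exp (\<kappa> * (i * ln (sqrt (1 / 2))))"
      by (simp add: powr_def ln_realpow)
    also have "ln (sqrt (1 / 2)) = - ln 2 / 2" by (simp add: ln_sqrt ln_div)
    finally show ?thesis by (simp add: c_def mult_ac)
  qed
  have "((\<lambda>i. (real i + 2) powr (\<theta> - 1)) \<longlongrightarrow> 0) sequentially"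
    using assms by (intro tendsto_neg_powr) (auto intro!: filterlim_tendsto_add_at_top[OF _ filterlim_real_sequentially] simp: add.commute[of _ 2])
  \<comment> \<open>With \<open>i + 2 \<le> 2 * i\<close> for \<open>i \<ge> 2\<close>, the constant
    \<open>c / 8\<close> yields the slope \<open>c / 2\<close>.\<close>
  hence "\<forall>\<^sub>F i in sequentially. (real i + 2) powr (\<theta> - 1) < c / 8"
    using c by (intro order_tendstoD) auto
  hence ev: "\<forall>\<^sub>F i in sequentially. 2 * (real i + 2) powr \<theta> \<le> c / 2 * i"
    using eventually_ge_at_top[of 2]
  proof eventually_elim
    case (elim i)
    have "(real i + 2) powr \<theta> = (real i + 2) powr (\<theta> - 1) * (real i + 2)"
      using powr_add[of "real i + 2" "\<theta> - 1" 1] by simp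
    also have "\<dots> \<le> c / 8 * (real i + real i)"
      using elim c by (intro mult_mono) auto
    finally show ?case by simp
  qed
  have "summable (\<lambda>i. 2 powr \<kappa> * (\<bar>M\<bar> + \<bar>C\<bar>) * exp (- c / 2) ^ i)"
    using c by (intro summable_mult summable_geometric) auto
  thus ?thesis
  proof (rule summable_comparison_test_ev[rotated])
    show "\<forall>\<^sub>F i in sequentially. norm ((2 * sqrt (1 / 2) ^ i) powr \<kappa> * (M + C * exp (2 * (real i + 2) powr \<theta>)))
        \<le> 2 powr \<kappa> * (\<bar>M\<bar> + \<bar>C\<bar>) * exp (- c / 2) ^ i"
      using ev
    proof eventually_elim
      case (elim i)
      have "\<bar>M + C * exp (2 * (real i + 2) powr \<theta>)\<bar> \<le> \<bar>M\<bar> * 1 + \<bar>C\<bar> * exp (2 * (real i + 2) powr \<theta>)"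
        by (rule order_trans[OF abs_triangle_ineq]) (simp add: abs_mult)
      also have "\<dots> \<le> \<bar>M\<bar> * exp (c / 2 * i) + \<bar>C\<bar> * exp (c / 2 * i)"
        using elim c by (intro add_mono mult_left_mono) auto
      finally have "\<bar>M + C * exp (2 * (real i + 2) powr \<theta>)\<bar> \<le> (\<bar>M\<bar> + \<bar>C\<bar>) * exp (c / 2 * i)"
        by (simp add: algebra_simps)
      hence "norm ((2 * sqrt (1 / 2) ^ i) powr \<kappa> * (M + C * exp (2 * (real i + 2) powr \<theta>)))
         \<le> 2 powr \<kappa> * exp (- c * i) * ((\<bar>M\<bar> + \<bar>C\<bar>) * exp (c / 2 * i))"
        unfolding eq norm_mult by (intro mult_mono) auto
      also have "\<dots> = 2 powr \<kappa> * (\<bar>M\<bar> + \<bar>C\<bar>) * (exp (- c * i) * exp (c / 2 * i))" by (simp add: mult_ac)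
      also have "exp (- c * i) * exp (c / 2 * i) = exp (- c / 2) ^ i"
        by (simp add: exp_of_nat_mult[symmetric] mult_ac flip: exp_add)
      finally show ?case .
    qed
  qed
qed

text \<open>In the application \<open>y\<close> is a convergent and \<open>c\<close> the orbit of
  \<open>frac x\<close>. For negative \<open>y\<close> the orbits of \<open>frac (- y)\<close> and
  \<open>frac y\<close> agree up to an index shift by one in either direction; \<open>i + 2\<close>
  in place of \<open>i + 1\<close>, and the start at \<open>N + 2\<close>, absorb it.\<close>

lemma gauss_orbit_abs_convergent_dichotomy:
  assumes p: "p > 0" and N: "\<And>i. i \<ge> N \<Longrightarrow> (real i + 1) powr (- p) \<le> c i"
    and y: "\<And>i. gauss_orbit (frac y) i = 0 \<or> c i / 2 \<le> gauss_orbit (frac y) i"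
    and i: "i \<ge> N + 2"
  shows "gauss_orbit (frac \<bar>y\<bar>) i = 0 \<or> (real i + 2) powr (- p) / 2 \<le> gauss_orbit (frac \<bar>y\<bar>) (i::nat)"
proof -
  have *: "gauss_orbit (frac y) l = 0 \<or> (real i + 2) powr (- p) / 2 \<le> gauss_orbit (frac y) l"
    if "l \<ge> N" "l \<le> Suc i" for l
  proof -
    have "(real i + 2) powr (- p) \<le> (real l + 1) powr (- p)"
      using that p by (intro powr_mono2') auto
    thus ?thesis using N[OF that(1)] y[of l] by linarith
  qed
  obtain m where m: "i = Suc (Suc m)" using i by (metis add_2_eq_Suc' le_Suc_ex add_Suc)
  show ?thesis
  proof (cases "y \<ge> 0")
    case True
    thus ?thesis using *[of i] i by simp
  next
    case False
    hence "\<bar>y\<bar> = - y" by simp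
    thus ?thesis using gauss_orbit_frac_minus[of y]
    proof (elim disjE)
      assume "\<forall>i. gauss_orbit (frac (- y)) (Suc (Suc i)) = gauss_orbit (frac y) (Suc i)"
      hence "gauss_orbit (frac \<bar>y\<bar>) i = gauss_orbit (frac y) (Suc m)"
        using \<open>\<bar>y\<bar> = - y\<close> m by metis
      thus ?thesis using *[of "Suc m"] i m by (simp del: funpow.simps)
    next
      assume "\<forall>i. gauss_orbit (frac (- y)) (Suc i) = gauss_orbit (frac y) (Suc (Suc i))"
      hence "gauss_orbit (frac \<bar>y\<bar>) i = gauss_orbit (frac y) (Suc i)"
        using \<open>\<bar>y\<bar> = - y\<close> m by metis
      thus ?thesis using *[of "Suc i"] i by simp
    qed
  qed
qed

section \<open>Limits of \<open>f\<close> along convergents and along all rationals\<close>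

context period_function
begin

text \<open>The values at \<open>1\<close> and \<open>- 1\<close> account for terminated orbits. For
  \<open>\<delta> < 1\<close> the growth bound decreases in the modulus, so it is worst at
  \<open>c\<close>.\<close>

lemma norm_base_value_le:
  assumes growth: "\<And>x. x \<noteq> 0 \<Longrightarrow> \<bar>x\<bar> \<le> 1 \<Longrightarrow> norm (h x) \<le> C * exp (\<bar>x\<bar> powr (\<delta> - 1))"
    and \<delta>: "\<delta> < 1" and s: "s \<in> {1, - 1}" and c: "0 < c" and t: "t = 0 \<or> c \<le> t" "t < 1"
  shows "norm (base_value f h s t) \<le> norm (f 1) + norm (f (- 1)) + \<bar>C\<bar> * exp (c powr (\<delta> - 1))"
proof (cases "t = 0")
  case True
  moreover have "0 \<le> \<bar>C\<bar> * exp (c powr (\<delta> - 1))" by simp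
  ultimately show ?thesis using s by (auto simp: base_value_def intro: add_increasing2 add_increasing)
next
  case False
  hence t: "c \<le> t" "t < 1" using t by auto
  have st: "\<bar>real_of_rat s * t\<bar> = t" using s t c by (auto simp: abs_mult)
  have "norm (h (real_of_rat s * t)) \<le> C * exp (t powr (\<delta> - 1))"
    using growth[of "real_of_rat s * t"] s t c False unfolding st by auto
  also have "\<dots> \<le> \<bar>C\<bar> * exp (c powr (\<delta> - 1))"
    using t c \<delta> by (intro mult_mono) (auto intro!: powr_mono2')
  finally show ?thesis using False by (simp add: base_value_def add_increasing)
qed

text \<open>Orbit points of size at least \<open>(i + 2) powr (- p) / 2\<close> make
  \<open>h\<close> grow at most like the exponential of a multiple of
  \<open>i powr (p * (1 - \<delta>))\<close>, and this is subexponential.\<close>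

lemma f_convergents_tendsto:
  assumes growth: "\<And>x. x \<noteq> 0 \<Longrightarrow> \<bar>x\<bar> \<le> 1 \<Longrightarrow> norm (h x) \<le> C * exp (\<bar>x\<bar> powr (\<delta> - 1))"
    and \<delta>: "0 < \<delta>" "\<delta> < 1" and p: "0 < p" "p * (1 - \<delta>) < 1" and x: "x \<in> slow_orbits p"
  shows "(\<lambda>j. f (cf_conv x j)) \<longlonglongrightarrow> orbit_series k f h x"
proof -
  have irr: "x \<notin> \<rat>" using x by (simp add: slow_orbits_def)
  obtain N where N: "\<And>i. i \<ge> N \<Longrightarrow> (real i + 1) powr (- p) \<le> gauss_orbit (frac x) i"
    using x by (auto simp: slow_orbits_def eventually_sequentially)
  define M where "M = norm (f 1) + norm (f (- 1))"
  define B where "B i = M + \<bar>C\<bar> * exp (2 * (real i + 2) powr (p * (1 - \<delta>)))" for i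
  \<comment> \<open>The loss of \<open>1 / 2\<close> in passing to convergents costs only the factor
    \<open>2 powr (1 - \<delta>) \<le> 2\<close>.\<close>
  have eB: "((real i + 2) powr (- p) / 2) powr (\<delta> - 1) \<le> 2 * (real i + 2) powr (p * (1 - \<delta>))" for i
  proof -
    have "((real i + 2) powr (- p) / 2) powr (\<delta> - 1) = ((real i + 2) powr (- p)) powr (\<delta> - 1) / 2 powr (\<delta> - 1)"
      by (simp add: powr_divide)
    also have "((real i + 2) powr (- p)) powr (\<delta> - 1) = (real i + 2) powr (p * (1 - \<delta>))"
      by (simp add: powr_powr algebra_simps)
    also have "\<dots> / 2 powr (\<delta> - 1) = 2 powr (1 - \<delta>) * (real i + 2) powr (p * (1 - \<delta>))"
      by (simp add: powr_diff field_simps)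
    also have "\<dots> \<le> 2 powr 1 * (real i + 2) powr (p * (1 - \<delta>))"
      using \<delta> by (intro mult_right_mono powr_mono) auto
    finally show ?thesis by simp
  qed
  show ?thesis
  proof (rule f_tendsto_orbit_series[where N = "N + 2" and B = B])
    show "summable (\<lambda>i. (2 * sqrt (1 / 2) ^ i) powr (- Re k) * B i)"
      unfolding B_def using k_neg p by (intro summable_geometric_subexp) auto
    show "\<forall>\<^sub>F j in sequentially. \<forall>i\<ge>N + 2. \<forall>s\<in>{1, -1}.
       norm (base_value f h s (gauss_orbit (frac \<bar>real_of_rat (cf_conv x j)\<bar>) i)) \<le> B i"
    proof (intro always_eventually allI impI ballI)
      fix i j :: nat and s :: rat
      assume i: "i \<ge> N + 2" and s: "s \<in> {1, - 1}"
      let ?t = "gauss_orbit (frac \<bar>real_of_rat (cf_conv x j)\<bar>) i"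
      have "?t = 0 \<or> (real i + 2) powr (- p) / 2 \<le> ?t"
        by (rule gauss_orbit_abs_convergent_dichotomy[OF p(1) N gauss_orbit_convergent[OF irr] i])
      hence "norm (base_value f h s ?t) \<le> M + \<bar>C\<bar> * exp (((real i + 2) powr (- p) / 2) powr (\<delta> - 1))"
        unfolding M_def using growth \<delta> s
        by (intro norm_base_value_le gauss_orbit_bounds) (auto simp: frac_lt_1)
      also have "\<dots> \<le> B i" unfolding B_def using eB[of i] by (intro add_left_mono mult_left_mono) auto
      finally show "norm (base_value f h s ?t) \<le> B i" .
    qed
  qed (use irr in \<open>auto intro: cf_conv_tendsto\<close>)
qed

text \<open>A constant majorant serves all orbits at once, so no restriction on how the rationals
  approach \<open>x\<close> arises. The filter consists of rationals tending to
  \<open>x\<close>.\<close>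

lemma f_rat_tendsto_of_bounded:
  assumes "bounded (h ` (- {0}))" and x: "x \<notin> \<rat>"
  shows "(f \<longlongrightarrow> orbit_series k f h x) (filtercomap real_of_rat (at x))"
proof -
  obtain M where M: "\<And>x. x \<noteq> 0 \<Longrightarrow> norm (h x) \<le> M"
    using assms(1) by (auto simp: bounded_iff)
  have M0: "0 \<le> M" using M[of 1] norm_ge_zero[of "h 1"] by linarith
  define B where "B = norm (f 1) + norm (f (- 1)) + M"
  have ne: "filtercomap real_of_rat (at x) \<noteq> bot"
  proof (rule filtercomap_neq_bot)
    fix P assume "eventually P (at x)"
    then obtain d where d: "d > 0" "\<And>y. y \<noteq> x \<Longrightarrow> dist y x < d \<Longrightarrow> P y"
      by (auto simp: eventually_at)
    obtain q where "x < real_of_rat q" "real_of_rat q < x + d"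
      using of_rat_dense[of x "x + d"] d by auto
    thus "\<exists>q. P (real_of_rat q)" using d by (intro exI[of _ q]) (auto simp: dist_real_def)
  qed
  have "((\<lambda>q. f (id q)) \<longlongrightarrow> orbit_series k f h x) (filtercomap real_of_rat (at x))"
  proof (rule f_tendsto_orbit_series[where N = 0 and B = "\<lambda>_. B", OF x ne])
    have "((\<lambda>x. x) \<longlongrightarrow> x) (at x)" by (rule tendsto_ident_at)
    thus "((\<lambda>q. real_of_rat (id q)) \<longlongrightarrow> x) (filtercomap real_of_rat (at x))"
      using filterlim_compose filterlim_filtercomap by fastforce
    show "summable (\<lambda>i. (2 * sqrt (1 / 2) ^ i) powr (- Re k) * B)"
      using summable_geometric_subexp[of "- Re k" 0 B 0] k_neg by simp
    show "\<forall>\<^sub>F q in filtercomap real_of_rat (at x). \<forall>i\<ge>0. \<forall>s\<in>{1, -1}.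
       norm (base_value f h s (gauss_orbit (frac \<bar>real_of_rat (id q)\<bar>) i)) \<le> B"
    proof (intro always_eventually allI impI ballI)
      fix q i and s :: rat assume "s \<in> {1, - 1}"
      thus "norm (base_value f h s (gauss_orbit (frac \<bar>real_of_rat (id q)\<bar>) i)) \<le> B"
        using M M0 by (auto simp: base_value_def B_def intro: add_increasing add_increasing2 order_trans[OF M])
    qed
  qed
  thus ?thesis by simp
qed

end

section \<open>Measurability and continuity off a small set\<close>

lemma measurable_cf_rem [measurable]: "(\<lambda>x. cf_rem x i) \<in> borel_measurable borel"
proof (induction i)
  case (Suc i)
  have [measurable]: "(\<lambda>x. cf_rem x i) \<in> borel_measurable borel" by fact
  show ?case by (simp add: frac_def)
qed simp

lemma measurable_cf_digit [measurable]: "(\<lambda>x. cf_digit x i) \<in> borel \<rightarrow>\<^sub>M count_space UNIV"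
  unfolding cf_digit_def by measurable

text \<open>The rationals carry the discrete sigma-algebra, so composition with an arbitrary
  \<open>f\<close> stays measurable.\<close>

lemma measurable_cf_eval: "(\<lambda>x. cf_eval (cf_digit x) i n) \<in> borel \<rightarrow>\<^sub>M count_space UNIV"
proof (induction n arbitrary: i)
  case (Suc n)
  have "(\<lambda>x. of_int a + 1 / cf_eval (cf_digit x) (Suc i) n) \<in> borel \<rightarrow>\<^sub>M count_space UNIV" for a
    by (rule measurable_compose[OF Suc]) simp
  from measurable_compose_countable[OF this measurable_cf_digit[of i]] show ?case by simp
qed (simp add: measurable_compose[OF measurable_cf_digit])

lemma measurable_fdag: "fdag f \<in> borel_measurable borel"
proof -
  have [measurable]: "(\<lambda>x. f (cf_conv x j)) \<in> borel_measurable borel" for j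
    unfolding cf_conv_def by (rule measurable_compose[OF measurable_cf_eval]) simp
  show ?thesis unfolding fdag_def[abs_def] by measurable
qed

text \<open>Each preimage of a basic open set is enlarged to an open set with excess below
  \<open>e / 2 ^ (n + 1)\<close>. Off the union \<open>R\<close> of the excesses the two sets
  coincide, so preimages of open sets are relatively open.\<close>

lemma lusin:
  fixes g :: "'a::euclidean_space \<Rightarrow> 'b::second_countable_topology"
  assumes g: "g \<in> borel_measurable borel" and e: "e > 0"
  obtains R where "R \<in> sets borel" "emeasure lebesgue R \<le> ennreal e" "continuous_on (- R) g"
proof -
  obtain \<B> :: "'b set set" where \<B>: "countable \<B>" "topological_basis \<B>"
    using ex_countable_basis by blast
  have ne: "\<B> \<noteq> {}" using topological_basisE[OF \<B>(2), of UNIV] by blast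
  define V where "V n = from_nat_into \<B> n" for n
  have V: "range V = \<B>" using \<B>(1) ne unfolding V_def by (rule range_from_nat_into[rotated])
  have A: "g -` V n \<in> sets borel" for n
  proof -
    have "open (V n)" using V \<B>(2) by (metis rangeI topological_basis_open)
    thus ?thesis using measurable_sets[OF g, of "V n"] by simp
  qed
  have "\<exists>U. open U \<and> g -` V n \<subseteq> U \<and> emeasure lebesgue (U - g -` V n) < ennreal (e * (1 / 2) ^ Suc n)" for n
    using sets_lebesgue_outer_open[OF sets_completionI_sets[OF A[folded sets_lborel]], of "e * (1 / 2) ^ Suc n"] e by (metis mult_pos_pos zero_less_power half_gt_zero_iff zero_less_one)
  then obtain U where U: "\<And>n. open (U n)" "\<And>n. g -` V n \<subseteq> U n"
      "\<And>n. emeasure lebesgue (U n - g -` V n) < ennreal (e * (1 / 2) ^ Suc n)" by metis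
  define R where "R = (\<Union>n. U n - g -` V n)"
  have sets: "U n - g -` V n \<in> sets borel" for n
    using A U(1) by (intro sets.Diff) auto
  show ?thesis
  proof
    show "R \<in> sets borel" unfolding R_def using sets by blast
    have "emeasure lebesgue R \<le> (\<Sum>n. emeasure lebesgue (U n - g -` V n))"
      unfolding R_def using sets by (intro emeasure_subadditive_countably) auto
    also have "\<dots> \<le> (\<Sum>n. ennreal (e * (1 / 2) ^ Suc n))"
      using U(3) by (intro suminf_le) (auto intro: less_imp_le)
    also have "\<dots> = ennreal (e * 1)"
      using e by (intro suminf_ennreal_eq sums_mult power_half_series) auto
    finally show "emeasure lebesgue R \<le> ennreal e" by simp
    show "continuous_on (- R) g"
      unfolding continuous_on_open_invariant
    proof (intro allI impI)
      fix W :: "'b set" assume "open W"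
      then obtain \<B>' where \<B>': "\<B>' \<subseteq> \<B>" "\<Union>\<B>' = W"
        using \<B>(2) unfolding topological_basis_def by blast
      let ?U = "\<Union>n\<in>{n. V n \<in> \<B>'}. U n"
      have "x \<in> ?U \<longleftrightarrow> g x \<in> W" if "x \<notin> R" for x
      proof -
        have "x \<in> U n \<longleftrightarrow> g x \<in> V n" for n using that U(2)[of n] by (auto simp: R_def)
        moreover have "\<B>' = V ` {n. V n \<in> \<B>'}" using V \<B>'(1) by blast
        ultimately show ?thesis using \<B>'(2) by blast
      qed
      moreover have "open ?U" using U(1) by blast
      ultimately show "\<exists>A. open A \<and> A \<inter> - R = g -` W \<inter> - R" by (intro exI[of _ ?U]) auto
    qed
  qed
qed

text \<open>The series depends only on the sign of \<open>x\<close> and on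
  \<open>frac \<bar>x\<bar>\<close>; the representatives lie in \<open>(0, 1)\<close> and
  \<open>(- 1, 0)\<close>.\<close>

lemma orbit_series_periodic:
  assumes "x \<notin> \<rat>"
  shows "orbit_series k f h x
    = (if x > 0 then orbit_series k f h (frac x) else orbit_series k f h (frac x - 1))"
proof -
  have fr: "0 < frac x" "frac x < 1" using assms by (auto simp: frac_gt_0_iff irrational_not_int frac_lt_1)
  have "frac (frac x) = frac x" using fr by (simp add: frac_eq)
  moreover have "frac (1 - frac x) = frac (- x)"
    using fr assms by (simp add: frac_neg irrational_not_int frac_eq)
  moreover have "x \<noteq> 0" using assms by auto
  ultimately show ?thesis using fr unfolding orbit_series_def by (cases "x > 0") simp_all
qed

lemma continuous_on_frac_irrational: "continuous_on (- \<rat>) (frac :: real \<Rightarrow> real)"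
  by (intro continuous_at_imp_continuous_on ballI isCont_frac) simp

lemma fdag_continuous_off_small_set:
  fixes X :: "real set"
  assumes X: "X \<subseteq> - \<rat>" "- X \<in> null_sets lebesgue" "\<And>x. x + 1 \<in> X \<longleftrightarrow> x \<in> X"
    and per: "\<And>x. x \<in> X \<Longrightarrow> fdag f x = (if x > 0 then fdag f (frac x) else fdag f (frac x - 1))"
    and e: "e > 0"
  obtains Y where "Y \<subseteq> X" "Y \<in> sets lebesgue" "\<And>x. x \<in> Y \<longleftrightarrow> x + 1 \<in> Y"
    "emeasure lebesgue (Y \<inter> {0..1}) \<ge> ennreal (1 - e)" "continuous_on Y (fdag f)"
proof -
  have [measurable]: "fdag f \<in> borel_measurable borel" by (rule measurable_fdag)
  \<comment> \<open>Lusin's theorem for the pair gives one exceptional set for the periods on both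
    half-lines.\<close>
  have "(\<lambda>t. (fdag f t, fdag f (t - 1))) \<in> borel_measurable borel" by measurable
  from lusin[OF this e] obtain R where R: "R \<in> sets borel" "emeasure lebesgue R \<le> ennreal e"
    and cont: "continuous_on (- R) (\<lambda>t. (fdag f t, fdag f (t - 1)))" by blast
  define Y where "Y = {x \<in> X. frac x \<notin> R}"
  have XL: "X \<in> sets lebesgue"
    using sets.compl_sets[OF null_setsD2[OF X(2)]] by (simp add: Diff_Compl)
  have YX: "Y \<subseteq> X" by (auto simp: Y_def)
  hence YQ: "Y \<subseteq> - \<rat>" using X(1) by blast
  have Yfrac: "continuous_on Y frac" "frac ` Y \<subseteq> - R"
    using continuous_on_subset[OF continuous_on_frac_irrational YQ] by (auto simp: Y_def)
  have c: "continuous_on Y (\<lambda>x. (fdag f (frac x), fdag f (frac x - 1)))"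
    using continuous_on_compose2[OF cont Yfrac] .
  have c1: "continuous_on Y (\<lambda>x. fdag f (frac x))" and c2: "continuous_on Y (\<lambda>x. fdag f (frac x - 1))"
    using continuous_on_fst[OF c] continuous_on_snd[OF c] by simp_all
  show ?thesis
  proof
    show "Y \<subseteq> X" by fact
    have [measurable]: "R \<in> sets borel" by fact
    have "{x. frac x \<in> - R} \<in> sets borel" unfolding frac_def by measurable
    hence "{x. frac x \<in> - R} \<in> sets lebesgue" by auto
    hence "X \<inter> {x. frac x \<in> - R} \<in> sets lebesgue" by (rule sets.Int[OF XL])
    also have "X \<inter> {x. frac x \<in> - R} = Y" by (auto simp: Y_def)
    finally show YL: "Y \<in> sets lebesgue" .
    show "x \<in> Y \<longleftrightarrow> x + 1 \<in> Y" for x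
      using frac_add_of_int[of 1 x] X(3)[of x] by (simp add: Y_def add.commute)
    \<comment> \<open>The two formulas need not agree at \<open>0\<close>, but \<open>Y\<close>
      contains only irrationals.\<close>
    have "continuous_on Y (\<lambda>x. if x \<le> 0 then fdag f (frac x - 1) else fdag f (frac x))"
      using YQ by (intro continuous_on_cases_le continuous_on_subset[OF c1] continuous_on_subset[OF c2]) auto
    moreover have "fdag f x = (if x \<le> 0 then fdag f (frac x - 1) else fdag f (frac x))" if "x \<in> Y" for x
      using per[of x] that YX by auto
    ultimately show "continuous_on Y (fdag f)" by (simp cong: continuous_on_cong)
    have XR: "- X \<union> R \<in> sets lebesgue" and Y01: "Y \<inter> {0..1} \<in> sets lebesgue"
      using YL R(1) null_setsD2[OF X(2)] by auto
    have "{0..<1} \<subseteq> (Y \<inter> {0..1}) \<union> (- X \<union> R)"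
      by (auto simp: Y_def frac_eq[THEN iffD2])
    hence "emeasure lebesgue {0..<1::real} \<le> emeasure lebesgue ((Y \<inter> {0..1}) \<union> (- X \<union> R))"
      by (intro emeasure_mono sets.Un XR Y01)
    also have "\<dots> \<le> emeasure lebesgue (Y \<inter> {0..1}) + emeasure lebesgue (- X \<union> R)"
      by (intro emeasure_subadditive XR Y01)
    also have "emeasure lebesgue (- X \<union> R) = emeasure lebesgue R"
      using R(1) by (subst Un_commute) (intro emeasure_Un_null_set X(2), auto)
    also have "emeasure lebesgue (Y \<inter> {0..1}) + emeasure lebesgue R \<le> emeasure lebesgue (Y \<inter> {0..1}) + ennreal e"
      by (intro add_left_mono R)
    finally have le: "1 \<le> emeasure lebesgue (Y \<inter> {0..1}) + ennreal e" by simp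
    show "emeasure lebesgue (Y \<inter> {0..1}) \<ge> ennreal (1 - e)"
    proof (cases "e \<le> 1")
      case True
      have "ennreal e + ennreal (1 - e) = 1" using e True by (simp flip: ennreal_plus)
      with le have "ennreal e + ennreal (1 - e) \<le> ennreal e + emeasure lebesgue (Y \<inter> {0..1})"
        by (simp add: add.commute)
      thus ?thesis by (simp add: ennreal_add_left_cancel_le)
    qed (simp add: ennreal_neg)
  qed
qed

section \<open>Choice of \<open>X\<close> and deduction of the limit statements\<close>

theorem theorem1p2:

  fixes k :: complex and \<delta> :: real
    and f :: "rat \<Rightarrow> complex" and h :: "real \<Rightarrow> complex"
  assumes k_neg: "Re k < 0"
    and delta_pos: "\<delta> > 0"
    and f_per: "\<And>x::rat. \<not> (-1 \<le> x \<and> x \<le> 0) \<Longrightarrow> f x = f (x + 1)"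
    and h_def: "\<And>x::rat. x \<noteq> 0 \<Longrightarrow> -1 \<le> x \<Longrightarrow> x \<le> 1 \<Longrightarrow>
        h (real_of_rat x) = f x - (complex_of_real \<bar>real_of_rat x\<bar>) powr (-k) * f (- 1 / x)"
    and h_osc: "\<forall>e>0. \<exists>\<epsilon>0>0. \<forall>\<epsilon>. 0 < \<epsilon> \<and> \<epsilon> < \<epsilon>0 \<longrightarrow>
        (\<forall>x y. x \<noteq> 0 \<and> y \<noteq> 0 \<and> \<bar>x - y\<bar> < exp (- (\<epsilon> powr (\<delta> - 1))) \<and> \<bar>x\<bar> > 2 * \<epsilon>
           \<longrightarrow> norm (h x - h y) \<le> e)"
    and h_growth: "\<exists>C. \<forall>x. x \<noteq> 0 \<and> \<bar>x\<bar> \<le> 1 \<longrightarrow> norm (h x) \<le> C * exp (\<bar>x\<bar> powr (\<delta> - 1))"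
  shows "\<exists>X. X \<subseteq> - \<rat> \<and> (- X) \<in> null_sets lebesgue
     \<and> (\<forall>x\<in>X. convergent (\<lambda>j. f (cf_conv x j)))
     \<and> (bounded (h ` (- {0})) \<longrightarrow>
          (\<forall>x\<in>X. \<forall>e>0. \<exists>d>0. \<forall>q::rat. 0 < \<bar>real_of_rat q - x\<bar> \<and> \<bar>real_of_rat q - x\<bar> < d
              \<longrightarrow> norm (f q - fdag f x) < e))
     \<and> (\<forall>\<epsilon>>0. \<exists>X\<epsilon>. X\<epsilon> \<subseteq> X \<and> X\<epsilon> \<in> sets lebesgue \<and> (\<forall>x. x \<in> X\<epsilon> \<longleftrightarrow> x + 1 \<in> X\<epsilon>)
          \<and> emeasure lebesgue (X\<epsilon> \<inter> {0..1}) \<ge> ennreal (1 - \<epsilon>)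
          \<and> continuous_on X\<epsilon> (fdag f))
     \<and> (\<lambda>x. if x \<in> X then fdag f x else 0) \<in> borel_measurable lebesgue"
  proof -
  obtain C where C: "\<And>x. x \<noteq> 0 \<Longrightarrow> \<bar>x\<bar> \<le> 1 \<Longrightarrow> norm (h x) \<le> C * exp (\<bar>x\<bar> powr (\<delta> - 1))"
    using h_growth by blast
  have h_cont: "isCont h x" if x: "x \<noteq> 0" for x
    unfolding continuous_at_eps_delta
  proof (intro allI impI)
    fix e :: real assume "e > 0"
    then obtain \<epsilon>0 where \<epsilon>0: "\<epsilon>0 > 0" "\<And>\<epsilon> x y. 0 < \<epsilon> \<Longrightarrow> \<epsilon> < \<epsilon>0 \<Longrightarrow> x \<noteq> 0 \<Longrightarrow> y \<noteq> 0 \<Longrightarrow>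
        \<bar>x - y\<bar> < exp (- (\<epsilon> powr (\<delta> - 1))) \<Longrightarrow> \<bar>x\<bar> > 2 * \<epsilon> \<Longrightarrow> norm (h x - h y) \<le> e / 2"
      using h_osc[rule_format, of "e / 2"] by (metis half_gt_zero)
    \<comment> \<open>Small enough for the oscillation bound at the given \<open>x\<close>; the
      minimum with \<open>\<bar>x\<bar>\<close> in the radius below keeps \<open>y\<close> away from
      \<open>0\<close>.\<close>
    define \<epsilon> where "\<epsilon> = min (\<epsilon>0 / 2) (\<bar>x\<bar> / 4)"
    have \<epsilon>: "0 < \<epsilon>" "\<epsilon> < \<epsilon>0" "2 * \<epsilon> < \<bar>x\<bar>" using \<epsilon>0(1) x by (auto simp: \<epsilon>_def min_def)
    show "\<exists>d>0. \<forall>y. dist y x < d \<longrightarrow> dist (h y) (h x) < e"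
    proof (intro exI[of _ "min \<bar>x\<bar> (exp (- (\<epsilon> powr (\<delta> - 1))))"] conjI allI impI)
      fix y assume y: "dist y x < min \<bar>x\<bar> (exp (- (\<epsilon> powr (\<delta> - 1))))"
      hence "norm (h x - h y) \<le> e / 2"
        using \<epsilon> x by (intro \<epsilon>0(2)[of \<epsilon>]) (auto simp: dist_real_def)
      thus "dist (h y) (h x) < e" using \<open>e > 0\<close> by (simp add: dist_norm norm_minus_commute)
    qed (use x in auto)
  qed
  interpret period_function k f h
    using k_neg f_per h_def h_cont by unfold_locales
  \<comment> \<open>Lowering the exponent parameter weakens the growth bound on
    \<open>\<bar>x\<bar> \<le> 1\<close> and covers \<open>\<delta> \<ge> 1\<close> as well.\<close>
  define d where "d = min \<delta> (1 / 2)"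
  have d: "0 < d" "d < 1" "d \<le> \<delta>" using delta_pos by (auto simp: d_def)
  \<comment> \<open>The exponent \<open>1 + d\<close> exceeds \<open>1\<close>, and
    \<open>(1 + d) * (1 - d) = 1 - d ^ 2\<close> is below \<open>1\<close>.\<close>
  define X where "X = slow_orbits (1 + d)"
  have XQ: "X \<subseteq> - \<rat>" by (auto simp: X_def slow_orbits_def)
  have Xnull: "- X \<in> null_sets lebesgue"
    unfolding X_def using d by (intro null_sets_slow_orbits_compl) auto
  have Xper: "x + 1 \<in> X \<longleftrightarrow> x \<in> X" for x by (simp add: X_def slow_orbits_add_1)
  have growth: "norm (h x) \<le> \<bar>C\<bar> * exp (\<bar>x\<bar> powr (d - 1))" if "x \<noteq> 0" "\<bar>x\<bar> \<le> 1" for x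
  proof -
    have "\<bar>x\<bar> powr (\<delta> - 1) \<le> \<bar>x\<bar> powr (d - 1)" using that d by (intro powr_mono') auto
    hence "C * exp (\<bar>x\<bar> powr (\<delta> - 1)) \<le> \<bar>C\<bar> * exp (\<bar>x\<bar> powr (d - 1))" by (intro mult_mono) auto
    with C[OF that] show ?thesis by linarith
  qed
  have "(1 + d) * (1 - d) < 1" using d by (simp add: algebra_simps)
  hence lim: "(\<lambda>j. f (cf_conv x j)) \<longlonglongrightarrow> orbit_series k f h x" if "x \<in> X" for x
    using f_convergents_tendsto[of "\<bar>C\<bar>" d "1 + d" x] growth that d by (simp add: X_def)
  hence fdag: "fdag f x = orbit_series k f h x" if "x \<in> X" for x
    using that by (simp add: fdag_def limI)
  \<comment> \<open>Both representatives must lie in \<open>X\<close> so that \<open>fdag\<close>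
    equals the series there.\<close>
  have Xint: "frac x \<in> X \<and> frac x - 1 \<in> X" if "x \<in> X" for x
  proof -
    have "frac (frac x) = frac x" "frac (frac x - 1) = frac x"
      using frac_add_of_int[of "- 1" "frac x"] by (simp_all add: frac_eq frac_lt_1)
    moreover have "frac x - 1 \<notin> \<rat>" "frac x \<notin> \<rat>"
      using that XQ calculation frac_rational_iff by (metis ComplD subsetD)+
    ultimately show ?thesis using that by (simp add: X_def slow_orbits_def)
  qed
  have per: "fdag f x = (if x > 0 then fdag f (frac x) else fdag f (frac x - 1))" if "x \<in> X" for x
    using orbit_series_periodic[of x k f h] that XQ Xint[OF that] by (auto simp: fdag)
  have bounded_case: "\<forall>x\<in>X. \<forall>e>0. \<exists>d>0. \<forall>q::rat. 0 < \<bar>real_of_rat q - x\<bar> \<and> \<bar>real_of_rat q - x\<bar> < d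
              \<longrightarrow> norm (f q - fdag f x) < e" if "bounded (h ` (- {0}))"
  proof (intro ballI allI impI)
    fix x and e :: real assume x: "x \<in> X" and e: "e > 0"
    have "(f \<longlongrightarrow> fdag f x) (filtercomap real_of_rat (at x))"
      using f_rat_tendsto_of_bounded[OF that, of x] x XQ by (auto simp: fdag)
    from tendstoD[OF this e] obtain Q where Q: "eventually Q (at x)"
      "\<And>q. Q (real_of_rat q) \<Longrightarrow> dist (f q) (fdag f x) < e"
      by (auto simp: eventually_filtercomap)
    thus "\<exists>d>0. \<forall>q::rat. 0 < \<bar>real_of_rat q - x\<bar> \<and> \<bar>real_of_rat q - x\<bar> < d
              \<longrightarrow> norm (f q - fdag f x) < e"
      unfolding eventually_at by (auto simp: dist_norm)
  qed
  have XL: "X \<in> sets lebesgue"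
    using sets.compl_sets[OF null_setsD2[OF Xnull]] by (simp add: Diff_Compl)
  have [measurable]: "fdag f \<in> borel_measurable lebesgue"
    using measurable_fdag by (intro measurable_completion) simp
  have meas: "(\<lambda>x. if x \<in> X then fdag f x else 0) \<in> borel_measurable lebesgue"
    using XL by (intro measurable_If_set) auto
  show ?thesis
  proof (rule exI[of _ X], intro conjI allI impI)
    fix \<epsilon> :: real assume "\<epsilon> > 0"
    from fdag_continuous_off_small_set[OF XQ Xnull Xper per this]
    show "\<exists>X\<epsilon>. X\<epsilon> \<subseteq> X \<and> X\<epsilon> \<in> sets lebesgue \<and> (\<forall>x. x \<in> X\<epsilon> \<longleftrightarrow> x + 1 \<in> X\<epsilon>)
          \<and> emeasure lebesgue (X\<epsilon> \<inter> {0..1}) \<ge> ennreal (1 - \<epsilon>)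
          \<and> continuous_on X\<epsilon> (fdag f)" by metis
  qed (use XQ Xnull bounded_case meas in \<open>auto intro: convergentI lim\<close>)
qed

end
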